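(* Let $\mathcal{F}=\{f_k\}_{k=1}^m$ be an injective CPLIFS that satisfies the Interval Open Set Condition (IOSC), and let $\Lambda$ be its attractor. Then $$\dim_{\rm H}\Lambda=\dim_{\rm B}\Lambda=s_{\mathcal{F}},$$ where $s_{\mathcal{F}}$ is the unique zero of the natural pressure function $\Phi^{\mathcal{F}}$ of $\mathcal{F}$.
   Context: A CPLIFS (continuous piecewise linear iterated function system) is a finite list $\mathcal{F}=\{f_k:\mathbb{R}\to\mathbb{R}\}_{k=1}^m$ of continuous functions such that each $f_k$ is piecewise affine with finitely many pieces (finitely many points where the slope changes), all slopes lying in $(-1,1)\setminus\{0\}$. It is called injective if every $f_k$ is injective. Its attractor $\Lambda$ is the unique non-empty compact set $\Lambda\subset\mathbb{R}$ with $\Lambda=\bigcup_{k=1}^m f_k(\Lambda)$. Write $[m]=\{1,\dots,m\}$ and $f_{i_1\dots i_n}=f_{i_1}\circ\cdots\circ f_{i_n}$. Let $I^{\mathcal{F}}$ be the intersection of all compact intervals $J\subset\mathbb{R}$ with $f_k(J)\subset J$ for all $k\in[m]$; it is the smallest non-empty compact interval mapped into itself by all $f_k$. The cylinder intervals are $I^{\mathcal{F}}_{i_1\dots i_n}=f_{i_1\dots i_n}(I^{\mathcal{F}})$; the first cylinder intervals are $I_k=f_k(I^{\mathcal{F}})$, $k\in[m]$. $\mathcal{F}$ satisfies the IOSC if $I_i\cap I_j=\emptyset$ for all $i,j\in[m]$ with $i\neq j$. The natural pressure function is, for $s\ge 0$, $$\Phi^{\mathcal{F}}(s)=\limsup_{n\to\infty}\frac1n\log\sum_{(i_1,\dots,i_n)\in[m]^n}|I^{\mathcal{F}}_{i_1\dots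 i_n}|^s,$$ where $|\cdot|$ denotes length (conventions $0^0=1$, $\log 0=-\infty$). It has a unique zero, denoted $s_{\mathcal{F}}$ and called the natural dimension of $\mathcal{F}$. $\dim_{\rm H}$ and $\dim_{\rm B}$ denote Hausdorff and box dimension; the statement includes that the box dimension exists. *)

theory Defs
  imports "HOL-Analysis.Analysis"
begin

text \<open>Real powers and logarithm with the conventions \<open>0^0 = 1\<close> and \<open>log 0 = -\<infinity>\<close>
  (the library has \<open>0 powr 0 = 0\<close> and \<open>ln 0 = 0\<close>).\<close>

definition rpow :: "real \<Rightarrow> real \<Rightarrow> real" where
  "rpow x s = (if s = 0 then 1 else x powr s)"

definition elog :: "real \<Rightarrow> ereal" where
  "elog x = (if x \<le> 0 then -\<infinity> else ereal (ln x))"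

text \<open>The covering sets are required to be bounded because \<^const>\<open>diameter\<close> is a real number,
  unspecified on unbounded sets. An empty covering set contributes \<open>0\<close>, also for \<open>s = 0\<close>.\<close>

definition hausdorff_premeasure :: "real \<Rightarrow> real \<Rightarrow> 'a::metric_space set \<Rightarrow> ennreal" where
  "hausdorff_premeasure s \<delta> A =
     (INF U \<in> {U :: nat \<Rightarrow> 'a set. A \<subseteq> (\<Union>i. U i) \<and> (\<forall>i. bounded (U i) \<and> diameter (U i) \<le> \<delta>)}.
        \<Sum>i. if U i = {} then 0 else ennreal (rpow (diameter (U i)) s))"

definition hausdorff_measure :: "real \<Rightarrow> 'a::metric_space set \<Rightarrow> ennreal" where
  "hausdorff_measure s A = (SUP \<delta> \<in> {0<..}. hausdorff_premeasure s \<delta> A)"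

definition hausdorff_dim :: "'a::metric_space set \<Rightarrow> ereal" where
  "hausdorff_dim A = Inf {ereal s | s. 0 \<le> s \<and> hausdorff_measure s A = 0}"

text \<open>The least number of sets of diameter at most \<open>\<delta>\<close> covering \<open>A\<close>; meaningful for
  totally bounded \<open>A\<close>.\<close>

definition covering_number :: "real \<Rightarrow> 'a::metric_space set \<Rightarrow> nat" where
  "covering_number \<delta> A =
     (LEAST n. \<exists>C. finite C \<and> card C = n \<and> A \<subseteq> \<Union>C \<and> (\<forall>U\<in>C. bounded U \<and> diameter U \<le> \<delta>))"

text \<open>The box dimension of \<open>A\<close> exists and equals \<open>d\<close>.\<close>

definition has_box_dim :: "'a::metric_space set \<Rightarrow> real \<Rightarrow> bool" where
  "has_box_dim A d \<longleftrightarrow>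
     ((\<lambda>\<delta>. ln (real (covering_number \<delta> A)) / - ln \<delta>) \<longlongrightarrow> d) (at_right 0)"

text \<open>\<open>B\<close> contains all the points where the slope changes, so \<open>f\<close> is affine on every interval
  avoiding \<open>B\<close>.\<close>

definition pw_affine_contraction :: "(real \<Rightarrow> real) \<Rightarrow> bool" where
  "pw_affine_contraction f \<longleftrightarrow> continuous_on UNIV f \<and>
     (\<exists>B. finite B \<and> (\<forall>J. is_interval J \<and> J \<inter> B = {} \<longrightarrow>
        (\<exists>\<rho> c. \<rho> \<in> {-1<..<1} - {0} \<and> (\<forall>x\<in>J. f x = \<rho> * x + c))))"

text \<open>A system is a list of maps; the index set \<open>[m]\<close> is rendered as \<open>{..<length F}\<close>.\<close>

definition cplifs :: "(real \<Rightarrow> real) list \<Rightarrow> bool" where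
  "cplifs F \<longleftrightarrow> F \<noteq> [] \<and> (\<forall>f \<in> set F. pw_affine_contraction f)"

definition injective_ifs :: "(real \<Rightarrow> real) list \<Rightarrow> bool" where
  "injective_ifs F \<longleftrightarrow> (\<forall>f \<in> set F. inj f)"

definition attractor :: "(real \<Rightarrow> real) list \<Rightarrow> real set" where
  "attractor F = (THE \<Lambda>. \<Lambda> \<noteq> {} \<and> compact \<Lambda> \<and> \<Lambda> = (\<Union>f \<in> set F. f ` \<Lambda>))"

text \<open>Non-emptiness of \<open>J\<close> is essential here: the empty set also satisfies \<^const>\<open>is_interval\<close>.\<close>

definition base_interval :: "(real \<Rightarrow> real) list \<Rightarrow> real set" where
  "base_interval F =
     \<Inter>{J. J \<noteq> {} \<and> compact J \<and> is_interval J \<and> (\<forall>f \<in> set F. f ` J \<subseteq> J)}"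

definition words :: "(real \<Rightarrow> real) list \<Rightarrow> nat \<Rightarrow> nat list set" where
  "words F n = {w. length w = n \<and> set w \<subseteq> {..<length F}}"

text \<open>\<open>word_map F [i\<^sub>1, \<dots>, i\<^sub>n] = F ! i\<^sub>1 \<circ> \<dots> \<circ> F ! i\<^sub>n\<close>\<close>

definition word_map :: "(real \<Rightarrow> real) list \<Rightarrow> nat list \<Rightarrow> real \<Rightarrow> real" where
  "word_map F w = foldr (\<lambda>i g. (F ! i) \<circ> g) w id"

definition cylinder :: "(real \<Rightarrow> real) list \<Rightarrow> nat list \<Rightarrow> real set" where
  "cylinder F w = word_map F w ` base_interval F"

definition iosc :: "(real \<Rightarrow> real) list \<Rightarrow> bool" where
  "iosc F \<longleftrightarrow> (\<forall>i < length F. \<forall>j < length F. i \<noteq> j \<longrightarrow> cylinder F [i] \<inter> cylinder F [j] = {})"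

definition natural_pressure :: "(real \<Rightarrow> real) list \<Rightarrow> real \<Rightarrow> ereal" where
  "natural_pressure F s =
     limsup (\<lambda>n. ereal (1 / real n) * elog (\<Sum>w \<in> words F n. rpow (measure lborel (cylinder F w)) s))"

definition natural_dim :: "(real \<Rightarrow> real) list \<Rightarrow> real" where
  "natural_dim F = (THE s. 0 \<le> s \<and> natural_pressure F s = 0)"

end

theory Submission
  imports Defs
begin

text \<open>
  Both dimensions are computed from the sums \<open>\<Sum> |I\<^sub>w|\<^sup>s\<close> over the words \<open>w\<close> of a given length.

  From above: if the pressure is negative at \<open>s\<close>, these sums are summable in the length. Cylinders of
  one level then cover the attractor with \<open>s\<close>-cost tending to \<open>0\<close> (\<open>hausdorff_measure_eq_0\<close>), and
  the number of cylinders longer than \<open>\<delta>\<close> is \<open>O(\<delta>\<^sup>-\<^sup>s)\<close>, which bounds the covering number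
  (\<open>covering_number_upper\<close>). The pressure is strictly decreasing and continuous
  (\<open>natural_pressure_shift\<close>), so this covers every \<open>s\<close> above its zero.

  From below: the difficulty is that a composition \<open>f\<^sub>w\<close> is only piecewise affine, so there is no
  bounded distortion, and \<open>|I\<^sub>u\<^sub>v|\<close> need not be comparable with \<open>|I\<^sub>u| |I\<^sub>v|\<close>. But the first cylinders are
  disjoint, so that a point lies in at most one cylinder of each level. Call a word singular if its
  cylinder contains the image of a point where the slope of some map changes; the number of singular
  words of a given length is bounded by a constant \<open>N\<close>. Call \<open>u\<close> regular over \<open>v\<close>
  if \<open>u' v\<close> is singular for no nonempty suffix \<open>u'\<close> of \<open>u\<close>. In this case \<open>f\<^sub>u\<close> is affine on \<open>I\<^sub>v\<close>
  (\<open>regular_affine\<close>), with a slope of modulus \<open>|I\<^sub>u\<^sub>v| / |I\<^sub>v|\<close>. Let \<open>P\<^sub>k(v)\<close> be the sum of the \<open>s\<close>-th powers of these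
  slopes over the regular \<open>u\<close> of length \<open>k\<close> (\<open>partition_sum\<close>).

  Cutting a word in front of its longest singular suffix \<open>v\<close> bounds the cylinder sum of level \<open>n\<close> by
  a sum of terms \<open>|I\<^sub>v|\<^sup>s P\<^sub>n\<^sub>-\<^sub>|\<^sub>v\<^sub>|(v)\<close>, with at most \<open>N\<close> words \<open>v\<close> of each length and with \<open>|I\<^sub>v|\<close>
  exponentially small in \<open>|v|\<close>. Hence, if every \<open>P\<^sub>k(v)\<close> decays like \<open>\<theta>\<^sup>k\<close> with the same
  \<open>\<theta> > r\<^sup>s\<close>, where \<open>r\<close> bounds all slopes, the cylinder sums decay as well and the pressure
  is negative (\<open>cylinder_sum_geometric_bound\<close>). The point is that infinitely many \<open>v\<close> occur, each with its own constant; a second renewal argument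
  (\<open>partition_sum_uniform_decay\<close>) compares \<open>v\<close> with its prefix of a fixed length and makes the
  constants uniform.

  Below the zero of the pressure there is therefore one fixed word \<open>v\<close> for which \<open>P\<^sub>k(v)\<close> is unbounded
  in \<open>k\<close>. For all but boundedly many regular \<open>u\<close>, the map \<open>f\<^sub>v\<close> is affine on \<open>I\<^sub>u\<^sub>v\<close>
  (\<open>partition_sum_return\<close>), and then \<open>f\<^sub>v \<circ> f\<^sub>u\<close> is a similarity from \<open>I\<^sub>v\<close> into itself. For a suitable
  \<open>k\<close> these similarities have disjoint images and the \<open>t\<close>-th powers of their ratios add up to at least
  \<open>1\<close>. The mass distribution principle for such a system (\<open>premeasure_lower_bound\<close>) bounds
  \<open>hausdorff_premeasure t \<delta>\<close> of the attractor from below, uniformly in \<open>\<delta>\<close>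
  (\<open>premeasure_attractor_pos\<close>). This gives the lower bounds of both dimensions.
\<close>

section \<open>A discrete mass distribution principle\<close>

text \<open>Masses \<open>p\<^sub>i\<close> are distributed over the images of \<open>x\<close> under the words of length \<open>n\<close> in the maps \<open>g\<^sub>i\<close>,
  and the value is the total mass of the image points in \<open>U\<close>. Unfolding the first letter
  of a word pulls \<open>U\<close> back along \<open>g\<^sub>i\<close>, so that words need not be mentioned.\<close>

primrec mass :: "'i set \<Rightarrow> ('i \<Rightarrow> real) \<Rightarrow> ('i \<Rightarrow> 'a \<Rightarrow> 'a) \<Rightarrow> 'a \<Rightarrow> nat \<Rightarrow> 'a set \<Rightarrow> real" where
  "mass G p g x 0 U = indicator U x"
| "mass G p g x (Suc n) U = (\<Sum>i\<in>G. p i * mass G p g x n (g i -` U))"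

lemma mass_nonneg:
  assumes "\<And>i. i \<in> G \<Longrightarrow> 0 \<le> p i"
  shows "0 \<le> mass G p g x n U"
  using assms by (induction n arbitrary: U) (auto intro!: sum_nonneg)

lemma mass_le_1:
  assumes "\<And>i. i \<in> G \<Longrightarrow> 0 \<le> p i" and "sum p G = 1"
  shows "mass G p g x n U \<le> 1"
proof (induction n arbitrary: U)
  case (Suc n)
  have "mass G p g x (Suc n) U \<le> (\<Sum>i\<in>G. p i * 1)"
    unfolding mass.simps using assms(1) Suc by (intro sum_mono mult_left_mono) auto
  then show ?case using assms(2) by simp
qed (simp add: indicator_def)

lemma mass_eq_0:
  assumes "x \<in> K" and "\<And>i. i \<in> G \<Longrightarrow> g i ` K \<subseteq> K" and "U \<inter> K = {}"
  shows "mass G p g x n U = 0"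
  using assms(3)
proof (induction n arbitrary: U)
  case 0
  then show ?case using assms(1) by (auto simp: indicator_def)
next
  case (Suc n)
  have "mass G p g x n (g i -` U) = 0" if "i \<in> G" for i
    using Suc.prems assms(2)[OF that] by (intro Suc.IH) auto
  then show ?case by simp
qed

lemma mass_cover:
  assumes p: "\<And>i. i \<in> G \<Longrightarrow> 0 \<le> p i" "sum p G = 1"
    and K: "x \<in> K" "\<And>i. i \<in> G \<Longrightarrow> g i ` K \<subseteq> K"
    and "finite A" and "K \<subseteq> (\<Union>a\<in>A. U a)"
  shows "1 \<le> (\<Sum>a\<in>A. mass G p g x n (U a))"
  using assms(6)
proof (induction n arbitrary: U)
  case 0
  then obtain a where a: "a \<in> A" "x \<in> U a" using K(1) by auto
  have "1 = mass G p g x 0 (U a)" using a by simp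
  also have "\<dots> \<le> (\<Sum>a\<in>A. mass G p g x 0 (U a))"
    by (rule member_le_sum[OF a(1) mass_nonneg[OF p(1)] assms(5)])
  finally show ?case .
next
  case (Suc n)
  have "1 \<le> (\<Sum>a\<in>A. mass G p g x n (g i -` U a))" if "i \<in> G" for i
    using subset_trans[OF K(2)[OF that] Suc.prems]
    by (intro Suc.IH) (simp only: vimage_UN[symmetric] image_subset_iff_subset_vimage)
  then have "(\<Sum>i\<in>G. p i * 1) \<le> (\<Sum>i\<in>G. p i * (\<Sum>a\<in>A. mass G p g x n (g i -` U a)))"
    using p(1) by (intro sum_mono mult_left_mono) auto
  also have "\<dots> = (\<Sum>a\<in>A. mass G p g x (Suc n) (U a))"
    unfolding mass.simps sum_distrib_left by (rule sum.swap)
  finally show ?case using p(2) by simp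
qed

text \<open>A set \<open>U\<close> of diameter at most \<open>e\<close> that meets the images of two different maps has \<open>e \<ge> d\<close>, and
  the total mass \<open>1\<close> is an adequate bound. If it meets the image of one map only, pulling it back by
  that map divides its mass by \<open>p\<^sub>i\<close>, hence by at most \<open>\<kappa>\<^sub>i\<^sup>t\<close>, and the diameter bound by \<open>\<kappa>\<^sub>i\<close>.
  The condition on \<open>\<Lambda> ^ n\<close> makes the bound valid when no letters remain.\<close>

lemma mass_le_powr:
  fixes g :: "'i \<Rightarrow> 'a::metric_space \<Rightarrow> 'a"
  assumes p: "\<And>i. i \<in> G \<Longrightarrow> 0 \<le> p i" "sum p G = 1" "\<And>i. i \<in> G \<Longrightarrow> p i \<le> \<kappa> i powr t"
    and K: "x \<in> K" "\<And>i. i \<in> G \<Longrightarrow> g i ` K \<subseteq> K"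
    and G: "finite G"
    and \<kappa>: "\<And>i. i \<in> G \<Longrightarrow> 0 < \<kappa> i" "\<And>i. i \<in> G \<Longrightarrow> \<kappa> i \<le> \<Lambda>"
    and exp: "\<And>i x y. \<lbrakk>i \<in> G; x \<in> K; y \<in> K\<rbrakk> \<Longrightarrow> \<kappa> i * dist x y \<le> dist (g i x) (g i y)"
    and d: "0 < d"
    and sep: "\<And>i j x y. \<lbrakk>i \<in> G; j \<in> G; i \<noteq> j; x \<in> K; y \<in> K\<rbrakk> \<Longrightarrow> d \<le> dist (g i x) (g j y)"
    and t: "0 \<le> t" and "\<Lambda> ^ n \<le> e" and "0 < e"
    and "\<And>x y. \<lbrakk>x \<in> U \<inter> K; y \<in> U \<inter> K\<rbrakk> \<Longrightarrow> dist x y \<le> e"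
  shows "mass G p g x n U \<le> max 1 (d powr (-t)) * e powr t"
  using assms(13-15)
proof (induction n arbitrary: U e)
  case 0
  have "1 \<le> e powr t" using 0 t by (simp add: ge_one_powr_ge_zero)
  then have "1 * 1 \<le> max 1 (d powr (-t)) * e powr t" by (intro mult_mono) auto
  then show ?case using mass_le_1[OF p(1,2), of g x 0 U] by linarith
next
  case (Suc n)
  show ?case
  proof (cases "\<exists>i\<in>G. \<exists>j\<in>G. i \<noteq> j \<and> g i -` U \<inter> K \<noteq> {} \<and> g j -` U \<inter> K \<noteq> {}")
    case True
    then obtain i j y z where ij: "i \<in> G" "j \<in> G" "i \<noteq> j" "y \<in> K" "z \<in> K" "g i y \<in> U" "g j z \<in> U"
      by auto
    have "g i y \<in> K" "g j z \<in> K" using ij K(2) by auto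
    then have "d \<le> e" using sep[of i j y z] Suc.prems(3)[of "g i y" "g j z"] ij by auto
    then have "1 \<le> (e / d) powr t" using d t by (intro ge_one_powr_ge_zero) auto
    also have "\<dots> = d powr (-t) * e powr t"
      using d Suc.prems(2) by (simp add: powr_divide powr_minus field_simps)
    also have "\<dots> \<le> max 1 (d powr (-t)) * e powr t" by (intro mult_right_mono) auto
    finally show ?thesis using mass_le_1[OF p(1,2), of g x "Suc n" U] by linarith
  next
    case False
    show ?thesis
    proof (cases "\<exists>i\<in>G. g i -` U \<inter> K \<noteq> {}")
      case True
      then obtain i where i: "i \<in> G" "g i -` U \<inter> K \<noteq> {}" by auto
      have "mass G p g x n (g j -` U) = 0" if "j \<in> G - {i}" for j
        using False i that by (intro mass_eq_0[where K = K] K) auto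
      then have "mass G p g x (Suc n) U = p i * mass G p g x n (g i -` U)"
        using i(1) G by (simp add: sum.remove[of G i])
      also have "\<dots> \<le> p i * (max 1 (d powr (-t)) * (e / \<kappa> i) powr t)"
      proof (rule mult_left_mono[OF Suc.IH p(1)[OF i(1)]])
        have "0 < \<Lambda>" using \<kappa> i(1) by force
        then have "\<kappa> i * \<Lambda> ^ n \<le> \<Lambda> * \<Lambda> ^ n"
          by (intro mult_right_mono \<kappa>(2) i(1)) simp
        then have "\<kappa> i * \<Lambda> ^ n \<le> e" using Suc.prems(1) by simp
        then show "\<Lambda> ^ n \<le> e / \<kappa> i" using \<kappa>(1)[OF i(1)] by (simp add: field_simps)
        show "0 < e / \<kappa> i" using \<kappa>(1)[OF i(1)] Suc.prems(2) by simp
        fix y z assume yz: "y \<in> g i -` U \<inter> K" "z \<in> g i -` U \<inter> K"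
        moreover have "g i y \<in> K" "g i z \<in> K" using yz K(2)[OF i(1)] by auto
        ultimately have "\<kappa> i * dist y z \<le> e"
          using exp[OF i(1), of y z] Suc.prems(3)[of "g i y" "g i z"] by auto
        then show "dist y z \<le> e / \<kappa> i" using \<kappa>(1)[OF i(1)] by (simp add: field_simps)
      qed
      also have "\<dots> \<le> \<kappa> i powr t * (max 1 (d powr (-t)) * (e / \<kappa> i) powr t)"
        using p(3)[OF i(1)] by (intro mult_right_mono) (auto simp: max_def)
      also have "\<dots> = max 1 (d powr (-t)) * e powr t"
        using \<kappa>(1)[OF i(1)] Suc.prems(2) by (simp add: powr_divide)
      finally show ?thesis .
    next
      case False
      then have "mass G p g x n (g i -` U) = 0" if "i \<in> G" for i
        using that by (intro mass_eq_0[where K = K] K) auto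
      then show ?thesis by (simp add: max_def)
    qed
  qed
qed

lemma hausdorff_premeasure_mono:
  assumes "A \<subseteq> B"
  shows "hausdorff_premeasure s \<delta> A \<le> hausdorff_premeasure s \<delta> B"
  unfolding hausdorff_premeasure_def using assms by (intro INF_superset_mono) auto

text \<open>The mass distribution principle with a finitely supported measure in place of a self-similar one:
  a countable cover is enlarged to an open one at the price of a small error in the sum, a finite
  subcover is chosen by compactness, and \<open>n\<close> is taken so large that all its members are wider
  than the pieces of level \<open>n\<close>. Neither a measure nor the limit set of the maps \<open>g\<^sub>i\<close> is constructed;
  it suffices that \<open>K\<close> is mapped into itself.\<close>

lemma premeasure_lower_bound:
  fixes g :: "'i \<Rightarrow> 'a::metric_space \<Rightarrow> 'a"
  assumes K: "compact K" "K \<noteq> {}" "\<And>i. i \<in> G \<Longrightarrow> g i ` K \<subseteq> K"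
    and G: "finite G"
    and \<kappa>: "\<And>i. i \<in> G \<Longrightarrow> 0 < \<kappa> i" "\<And>i. i \<in> G \<Longrightarrow> \<kappa> i < 1"
    and exp: "\<And>i x y. \<lbrakk>i \<in> G; x \<in> K; y \<in> K\<rbrakk> \<Longrightarrow> \<kappa> i * dist x y \<le> dist (g i x) (g i y)"
    and d: "0 < d"
    and sep: "\<And>i j x y. \<lbrakk>i \<in> G; j \<in> G; i \<noteq> j; x \<in> K; y \<in> K\<rbrakk> \<Longrightarrow> d \<le> dist (g i x) (g j y)"
    and t: "0 < t" and sum: "1 \<le> (\<Sum>i\<in>G. \<kappa> i powr t)"
  shows "\<exists>c>0. \<forall>\<delta>. ennreal c \<le> hausdorff_premeasure t \<delta> K"
proof -
  define Z where "Z = (\<Sum>i\<in>G. \<kappa> i powr t)"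
  define p where "p i = \<kappa> i powr t / Z" for i
  have Z: "1 \<le> Z" using sum by (simp add: Z_def)
  have p: "0 \<le> p i" "p i \<le> \<kappa> i powr t" for i
    using Z mult_left_mono[OF Z, of "\<kappa> i powr t"] by (auto simp: p_def field_simps)
  have p1: "sum p G = 1" using Z by (simp add: p_def Z_def flip: sum_divide_distrib)
  have G0: "G \<noteq> {}" using p1 by auto
  define \<Lambda> where "\<Lambda> = Max (\<kappa> ` G)"
  have \<Lambda>: "\<kappa> i \<le> \<Lambda>" if "i \<in> G" for i using that G by (simp add: \<Lambda>_def)
  have \<Lambda>1: "\<Lambda> < 1" "0 < \<Lambda>"
    using G G0 \<kappa> by (auto simp: \<Lambda>_def Max_gr_iff)
  obtain x0 where x0: "x0 \<in> K" using K(2) by auto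
  define C where "C = max 1 (d powr (-t)) * 4 powr t"
  have C: "0 < C" using d by (auto simp: C_def max_def)
  define c where "c = 1 / (2 * C)"
  have "ennreal c \<le> (\<Sum>i. if U i = {} then 0 else ennreal (rpow (diameter (U i)) t))"
    if U: "K \<subseteq> (\<Union>i. U i)" "\<And>i. bounded (U i)" for U :: "nat \<Rightarrow> 'a set"
  proof -
    define D where "D i = (if U i = {} then 0 else diameter (U i) powr t)" for i
    have D0: "0 \<le> D i" for i by (simp add: D_def)
    \<comment> \<open>Enlargement radii whose \<open>t\<close>-th powers add up to \<open>c\<close>.\<close>
    define \<eta> where "\<eta> i = (c / 2 * (1/2) ^ i) powr (1 / t)" for i :: nat
    have c: "0 < c" using C by (simp add: c_def)
    have \<eta>: "0 < \<eta> i" "\<eta> i powr t = c / 2 * (1/2) ^ i" for i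
      using c t by (auto simp: \<eta>_def powr_powr)
    define e where "e i = max (diameter (U i)) (\<eta> i)" for i
    have e0: "0 < e i" for i using \<eta>(1)[of i] by (simp add: e_def less_max_iff_disj)
    define V where "V i = (\<Union>x\<in>U i. ball x (e i))" for i
    have UV: "U i \<subseteq> V i" for i using e0[of i] by (auto simp: V_def)
    obtain A where A: "finite A" "K \<subseteq> (\<Union>a\<in>A. V a)"
    proof -
      have "K \<subseteq> (\<Union>i\<in>UNIV. V i)" using U(1) UV by blast
      moreover have "open (V i)" for i by (auto simp: V_def)
      ultimately show thesis using compactE_image[OF K(1), of UNIV V] that by (metis (no_types, lifting))
    qed
    have dV: "dist x y \<le> 4 * e i" if "x \<in> V i" "y \<in> V i" for x y i
    proof -
      obtain x' y' where xy: "x' \<in> U i" "y' \<in> U i" "dist x' x < e i" "dist y' y < e i"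
        using \<open>x \<in> V i\<close> \<open>y \<in> V i\<close> unfolding V_def mem_ball UN_iff by blast
      have "dist x' y' \<le> e i" using diameter_bounded_bound[OF U(2) xy(1,2)] by (simp add: e_def)
      moreover have "dist x y \<le> dist x' x + dist x' y' + dist y' y" by metric
      ultimately show ?thesis using xy e0[of i] by linarith
    qed
    have "\<forall>a\<in>A. eventually (\<lambda>n. \<Lambda> ^ n < 4 * e a) sequentially"
    proof
      fix a
      have "(\<lambda>n. \<Lambda> ^ n) \<longlonglongrightarrow> 0" using \<Lambda>1 by (intro LIMSEQ_realpow_zero) auto
      then show "eventually (\<lambda>n. \<Lambda> ^ n < 4 * e a) sequentially"
        using e0[of a] by (intro order_tendstoD(2)[of _ 0]) auto
    qed
    then have "eventually (\<lambda>n. \<forall>a\<in>A. \<Lambda> ^ n < 4 * e a) sequentially"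
      using A(1) by (simp add: eventually_ball_finite)
    then obtain n where n: "\<And>a. a \<in> A \<Longrightarrow> \<Lambda> ^ n < 4 * e a"
      using eventually_happens'[OF sequentially_bot] by blast
    have "mass G p g x0 n (V a) \<le> C * (D a + \<eta> a powr t)" if a: "a \<in> A" for a
    proof (cases "U a = {}")
      case True
      then have "V a = {}" by (simp add: V_def)
      then show ?thesis
        using mass_eq_0[where G = G and g = g and U = "V a", OF x0 K(3)] C D0[of a] by simp
    next
      case False
      have "mass G p g x0 n (V a) \<le> max 1 (d powr (-t)) * (4 * e a) powr t"
        by (rule mass_le_powr[where K = K and \<kappa> = \<kappa> and \<Lambda> = \<Lambda>, OF p(1) p1 p(2) x0 K(3) G \<kappa>(1) \<Lambda> exp d sep])
          (use n[OF a] e0[of a] dV t in \<open>simp_all add: less_imp_le\<close>)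
      also have "\<dots> = C * e a powr t"
        using e0[of a] by (simp add: C_def powr_mult)
      also have "e a powr t \<le> D a + \<eta> a powr t"
        using False by (auto simp: e_def D_def max_def)
      finally show ?thesis using C by simp
    qed
    then have "(\<Sum>a\<in>A. mass G p g x0 n (V a)) \<le> C * (\<Sum>a\<in>A. D a + \<eta> a powr t)"
      unfolding sum_distrib_left by (rule sum_mono)
    moreover have "1 \<le> (\<Sum>a\<in>A. mass G p g x0 n (V a))"
      by (rule mass_cover[OF p(1) p1 x0 K(3) A])
    moreover have "(\<Sum>a\<in>A. \<eta> a powr t) \<le> c"
    proof -
      have "(\<lambda>i. c / 2 * (1/2) ^ i) sums (c / 2 * 2)"
        using geometric_sums[of "1/2 :: real"] by (intro sums_mult) auto
      then have "(\<Sum>a\<in>A. c / 2 * (1/2) ^ a) \<le> c"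
        using sum_le_suminf[of "\<lambda>i. c / 2 * (1/2) ^ i" A] A(1) c
        by (simp add: sums_iff)
      then show ?thesis by (simp add: \<eta>)
    qed
    moreover have "C * ((\<Sum>a\<in>A. D a) + (\<Sum>a\<in>A. \<eta> a powr t)) \<le> C * ((\<Sum>a\<in>A. D a) + c)"
      using C calculation(3) by (intro mult_left_mono) simp_all
    ultimately have "1 \<le> C * ((\<Sum>a\<in>A. D a) + c)" by (simp add: sum.distrib)
    then have "c \<le> (\<Sum>a\<in>A. D a)" using C by (simp add: c_def field_simps)
    then have "ennreal c \<le> (\<Sum>a\<in>A. ennreal (D a))"
      using D0 by (simp add: sum_ennreal ennreal_leI)
    also have "\<dots> \<le> (\<Sum>i. ennreal (D i))" using A(1) by (intro sum_le_suminf) auto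
    also have "(\<lambda>i. ennreal (D i)) = (\<lambda>i. if U i = {} then 0 else ennreal (rpow (diameter (U i)) t))"
      using t by (auto simp: D_def rpow_def)
    finally show ?thesis .
  qed
  then have "ennreal c \<le> hausdorff_premeasure t \<delta> K" for \<delta>
    unfolding hausdorff_premeasure_def by (intro INF_greatest) auto
  moreover have "0 < c" using C by (simp add: c_def)
  ultimately show ?thesis by blast
qed

section \<open>Piecewise affine maps are bi-Lipschitz\<close>

text \<open>Relations between the endpoints of an interval that hold on intervals without break points and
  are preserved by concatenation hold on all intervals.\<close>

lemma interval_additive_induct:
  fixes B :: "real set"
  assumes "finite B"
    and base: "\<And>x y. x < y \<Longrightarrow> {x<..<y} \<inter> B = {} \<Longrightarrow> Q x y"
    and step: "\<And>x y z. x < y \<Longrightarrow> y < z \<Longrightarrow> Q x y \<Longrightarrow> Q y z \<Longrightarrow> Q x z"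
    and "x < y"
  shows "Q x y"
  using assms(4)
proof (induction "card ({x<..<y} \<inter> B)" arbitrary: x y rule: less_induct)
  case less
  show ?case
  proof (cases "{x<..<y} \<inter> B = {}")
    case True
    then show ?thesis using base less.prems by blast
  next
    case False
    then obtain b where b: "x < b" "b < y" "b \<in> B" by auto
    have "{x<..<b} \<inter> B \<subset> {x<..<y} \<inter> B" "{b<..<y} \<inter> B \<subset> {x<..<y} \<inter> B"
      using b by auto
    then have "card ({x<..<b} \<inter> B) < card ({x<..<y} \<inter> B)" "card ({b<..<y} \<inter> B) < card ({x<..<y} \<inter> B)"
      using assms(1) by (auto intro!: psubset_card_mono)
    then show ?thesis using less.hyps b step by blast
  qed
qed

text \<open>The definition provides some slope on each of infinitely many intervals. Finitely many slopes suffice,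
  because the components of the complement of \<open>B\<close> are determined by the set of points of \<open>B\<close> on their left.
  By continuity the formula extends to the endpoints of a component.\<close>

lemma pw_affine_contraction_slopes:
  assumes "pw_affine_contraction f"
  obtains B R where "finite B" "finite R" "R \<noteq> {}" "R \<subseteq> {-1<..<1} - {0}"
    "\<And>J. is_interval J \<Longrightarrow> J \<inter> B = {} \<Longrightarrow> \<exists>a c. \<forall>x\<in>J. f x = a * x + c"
    "\<And>x y. x < y \<Longrightarrow> {x<..<y} \<inter> B = {} \<Longrightarrow> \<exists>a\<in>R. f y - f x = a * (y - x)"
proof -
  obtain B where B0: "finite B \<and> (\<forall>J. is_interval J \<and> J \<inter> B = {} \<longrightarrow>
      (\<exists>a c. a \<in> {-1<..<1} - {0} \<and> (\<forall>x\<in>J. f x = a * x + c)))"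
    using assms unfolding pw_affine_contraction_def by (elim conjE exE) (rule that[OF conjI])
  have B: "finite B" "\<And>J. is_interval J \<Longrightarrow> J \<inter> B = {} \<Longrightarrow>
      \<exists>a c. a \<in> {-1<..<1} - {0} \<and> (\<forall>x\<in>J. f x = a * x + c)"
    using B0 by simp_all
  have cont: "continuous_on UNIV f" using assms by (simp add: pw_affine_contraction_def)
  \<comment> \<open>The points that have exactly the points of \<open>X\<close> on their left.\<close>
  define P where "P X = {x. (\<forall>b\<in>X. b < x) \<and> (\<forall>b\<in>B-X. x < b)}" for X
  have "\<exists>a. a \<in> {-1<..<1} - {0} \<and> (\<exists>c. \<forall>x\<in>P X. f x = a * x + c)" if "X \<subseteq> B" for X
  proof -
    have "is_interval (P X)" unfolding is_interval_1 P_def by (auto intro: less_le_trans le_less_trans)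
    moreover have "P X \<inter> B = {}" unfolding P_def by blast
    ultimately show ?thesis using B(2) by blast
  qed
  note ex_slope = this
  define a where "a X = (SOME a. a \<in> {-1<..<1} - {0} \<and> (\<exists>c. \<forall>x\<in>P X. f x = a * x + c))" for X
  have a: "a X \<in> {-1<..<1} - {0}" "\<exists>c. \<forall>x\<in>P X. f x = a X * x + c" if "X \<subseteq> B" for X
    using someI_ex[OF ex_slope[OF that]] unfolding a_def by blast+
  have sl: "\<exists>s\<in>a ` Pow B. f y - f x = s * (y - x)" if xy: "x < y" "{x<..<y} \<inter> B = {}" for x y
  proof -
    define X where "X = B \<inter> {..x}"
    obtain c where c: "\<forall>z\<in>P X. f z = a X * z + c" using a(2)[of X] by (auto simp: X_def)
    have sub: "{x<..<y} \<subseteq> P X"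
    proof
      fix z assume z: "z \<in> {x<..<y}"
      have "z < b" if "b \<in> B - X" for b
      proof (rule ccontr)
        assume "\<not> z < b"
        then have "b \<in> {x<..<y} \<inter> B" using that z by (auto simp: X_def)
        then show False using xy(2) by blast
      qed
      then show "z \<in> P X" using z by (auto simp: P_def X_def)
    qed
    have "closed {z. f z = a X * z + c}"
      using cont by (intro closed_Collect_eq continuous_intros)
    then have "closure {x<..<y} \<subseteq> {z. f z = a X * z + c}"
      using sub c by (intro closure_minimal) auto
    then have "f x = a X * x + c" "f y = a X * y + c"
      using xy(1) by (simp_all add: closure_greaterThanLessThan subset_iff)
    then have "f y - f x = a X * (y - x)" by (simp add: algebra_simps)
    then show ?thesis by (auto simp: X_def)
  qed
  have aff: "\<exists>a c. \<forall>x\<in>J. f x = a * x + c" if "is_interval J" "J \<inter> B = {}" for J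
    using B(2)[OF that] by blast
  have sub: "a ` Pow B \<subseteq> {-1<..<1} - {0}" by (intro image_subsetI a(1)) simp
  show thesis
  proof (rule that[of B "a ` Pow B"])
    show "\<exists>a c. \<forall>x\<in>J. f x = a * x + c" if "is_interval J" "J \<inter> B = {}" for J
      using that by (rule aff)
    show "\<exists>s\<in>a ` Pow B. f y - f x = s * (y - x)" if "x < y" "{x<..<y} \<inter> B = {}" for x y
      using that by (rule sl)
    show "finite (a ` Pow B)" "a ` Pow B \<noteq> {}" using B(1) by auto
  qed (fact B(1), fact sub)
qed

text \<open>The increments over adjacent intervals have the same sign, since a continuous injective
  map is monotone; so their absolute values add up, which the lower bound needs.\<close>

lemma injective_pw_affine_contraction_bilipschitz:
  assumes "pw_affine_contraction f" and "inj f"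
  shows "\<exists>\<rho> r B. 0 < \<rho> \<and> r < 1 \<and> finite B \<and>
    (\<forall>x y. \<rho> * \<bar>x - y\<bar> \<le> \<bar>f x - f y\<bar> \<and> \<bar>f x - f y\<bar> \<le> r * \<bar>x - y\<bar>) \<and>
    (\<forall>J. is_interval J \<longrightarrow> J \<inter> B = {} \<longrightarrow> (\<exists>a c. \<forall>x\<in>J. f x = a * x + c))"
proof -
  obtain B R where B: "finite B"
      "\<And>J. is_interval J \<Longrightarrow> J \<inter> B = {} \<Longrightarrow> \<exists>a c. \<forall>x\<in>J. f x = a * x + c"
    and R: "finite R" "R \<noteq> {}" "R \<subseteq> {-1<..<1} - {0}"
      "\<And>x y. x < y \<Longrightarrow> {x<..<y} \<inter> B = {} \<Longrightarrow> \<exists>a\<in>R. f y - f x = a * (y - x)"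
    by (rule pw_affine_contraction_slopes[OF assms(1)]) (rule that; assumption)
  have cont: "continuous_on S f" for S
    using assms(1) unfolding pw_affine_contraction_def by (blast intro: continuous_on_subset)
  define \<rho> r where "\<rho> = Min (abs ` R)" and "r = Max (abs ` R)"
  have "\<And>s. s \<in> R \<Longrightarrow> 0 < \<bar>s\<bar> \<and> \<bar>s\<bar> < 1" using R(3) by force
  then have \<rho>: "0 < \<rho>" and r: "r < 1"
    using R(1,2) by (auto simp: \<rho>_def r_def Min_gr_iff Max_less_iff)
  have bounds: "\<rho> \<le> \<bar>s\<bar>" "\<bar>s\<bar> \<le> r" if "s \<in> R" for s
    using that R(1) by (auto simp: \<rho>_def r_def)
  have less: "\<rho> * (y - x) \<le> \<bar>f y - f x\<bar> \<and> \<bar>f y - f x\<bar> \<le> r * (y - x)" if "x < y" for x y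
    using B(1) _ _ that
  proof (rule interval_additive_induct)
    fix x y :: real assume xy: "x < y" "{x<..<y} \<inter> B = {}"
    obtain s where s: "s \<in> R" "f y - f x = s * (y - x)" using R(4)[OF xy] by blast
    then have "\<bar>f y - f x\<bar> = \<bar>s\<bar> * (y - x)" using xy(1) by (simp add: abs_mult)
    then show "\<rho> * (y - x) \<le> \<bar>f y - f x\<bar> \<and> \<bar>f y - f x\<bar> \<le> r * (y - x)"
      using bounds[OF s(1)] xy(1) by (simp add: mult_right_mono)
  next
    fix x y z :: real
    assume *: "x < y" "y < z"
      and bxy: "\<rho> * (y - x) \<le> \<bar>f y - f x\<bar> \<and> \<bar>f y - f x\<bar> \<le> r * (y - x)"
      and byz: "\<rho> * (z - y) \<le> \<bar>f z - f y\<bar> \<and> \<bar>f z - f y\<bar> \<le> r * (z - y)"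
    have "(f x < f y \<and> f y < f z) \<or> (f z < f y \<and> f y < f x)"
      using continuous_inj_imp_mono[OF * cont inj_on_subset[OF assms(2)]] by simp
    then have "\<bar>f z - f x\<bar> = \<bar>f y - f x\<bar> + \<bar>f z - f y\<bar>" by auto
    moreover have "\<rho> * (z - x) = \<rho> * (y - x) + \<rho> * (z - y)" "r * (z - x) = r * (y - x) + r * (z - y)"
      by (simp_all add: algebra_simps)
    ultimately show "\<rho> * (z - x) \<le> \<bar>f z - f x\<bar> \<and> \<bar>f z - f x\<bar> \<le> r * (z - x)"
      using bxy byz by simp
  qed
  have "\<rho> * \<bar>x - y\<bar> \<le> \<bar>f x - f y\<bar> \<and> \<bar>f x - f y\<bar> \<le> r * \<bar>x - y\<bar>" for x y
    using less[of x y] less[of y x] by (cases x y rule: linorder_cases) (auto simp: abs_minus_commute)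
  then show ?thesis using \<rho> r B by blast
qed

lemma uniform_bilipschitz:
  assumes "\<forall>f\<in>set F. pw_affine_contraction f \<and> inj f"
  shows "\<exists>\<rho> r B. 0 < \<rho> \<and> r < 1 \<and> finite B \<and> (\<forall>f\<in>set F.
    (\<forall>x y. \<rho> * \<bar>x - y\<bar> \<le> \<bar>f x - f y\<bar> \<and> \<bar>f x - f y\<bar> \<le> r * \<bar>x - y\<bar>) \<and>
    (\<forall>J. is_interval J \<longrightarrow> J \<inter> B = {} \<longrightarrow> (\<exists>a c. \<forall>x\<in>J. f x = a * x + c)))"
  using assms
proof (induction F)
  case Nil
  show ?case by (intro exI[of _ 1] exI[of _ 0] exI[of _ "{}"]) simp
next
  case (Cons f F)
  obtain \<rho> r B where 1: "0 < \<rho>" "r < 1" "finite B"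
      "\<And>x y. \<rho> * \<bar>x - y\<bar> \<le> \<bar>f x - f y\<bar>" "\<And>x y. \<bar>f x - f y\<bar> \<le> r * \<bar>x - y\<bar>"
      "\<And>J. is_interval J \<Longrightarrow> J \<inter> B = {} \<Longrightarrow> \<exists>a c. \<forall>x\<in>J. f x = a * x + c"
    using injective_pw_affine_contraction_bilipschitz[of f] Cons.prems by auto
  obtain \<rho>' r' B' where 2: "0 < \<rho>'" "r' < 1" "finite B'"
      "\<And>f x y. f \<in> set F \<Longrightarrow> \<rho>' * \<bar>x - y\<bar> \<le> \<bar>f x - f y\<bar>"
      "\<And>f x y. f \<in> set F \<Longrightarrow> \<bar>f x - f y\<bar> \<le> r' * \<bar>x - y\<bar>"
      "\<And>f J. f \<in> set F \<Longrightarrow> is_interval J \<Longrightarrow> J \<inter> B' = {} \<Longrightarrow> \<exists>a c. \<forall>x\<in>J. f x = a * x + c"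
    using Cons.IH Cons.prems by auto
  have "min \<rho> \<rho>' * \<bar>x - y\<bar> \<le> \<rho> * \<bar>x - y\<bar>" "min \<rho> \<rho>' * \<bar>x - y\<bar> \<le> \<rho>' * \<bar>x - y\<bar>"
    "r * \<bar>x - y\<bar> \<le> max r r' * \<bar>x - y\<bar>" "r' * \<bar>x - y\<bar> \<le> max r r' * \<bar>x - y\<bar>" for x y :: real
    by (simp_all add: mult_right_mono)
  note bounds = this
  have "min \<rho> \<rho>' * \<bar>x - y\<bar> \<le> \<bar>g x - g y\<bar> \<and> \<bar>g x - g y\<bar> \<le> max r r' * \<bar>x - y\<bar>"
    if "g \<in> set (f # F)" for g x y
  proof (cases "g = f")
    case True
    show ?thesis unfolding True
      by (intro conjI order_trans[OF bounds(1) 1(4)] order_trans[OF 1(5) bounds(3)])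
  next
    case False
    then have g: "g \<in> set F" using that by simp
    show ?thesis
      by (intro conjI order_trans[OF bounds(2) 2(4)[OF g]] order_trans[OF 2(5)[OF g] bounds(4)])
  qed
  note lip = this
  have aff: "\<exists>a c. \<forall>x\<in>J. g x = a * x + c"
    if "g \<in> set (f # F)" "is_interval J" "J \<inter> (B \<union> B') = {}" for g J
  proof (cases "g = f")
    case True
    then show ?thesis using 1(6)[OF that(2)] that(3) by (simp add: Int_Un_distrib)
  next
    case False
    then show ?thesis using 2(6)[OF _ that(2)] that(1,3) by (simp add: Int_Un_distrib)
  qed
  show ?case
  proof (rule exI[of _ "min \<rho> \<rho>'"], rule exI[of _ "max r r'"], rule exI[of _ "B \<union> B'"],
      intro conjI ballI allI impI)
    show "0 < min \<rho> \<rho>'" using 1(1) 2(1) by simp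
    show "max r r' < 1" using 1(2) 2(2) by simp
    show "finite (B \<union> B')" using 1(3) 2(3) by simp
    show "min \<rho> \<rho>' * \<bar>x - y\<bar> \<le> \<bar>g x - g y\<bar>" if "g \<in> set (f # F)" for g x y
      using lip[OF that] by (rule conjunct1)
    show "\<bar>g x - g y\<bar> \<le> max r r' * \<bar>x - y\<bar>" if "g \<in> set (f # F)" for g x y
      using lip[OF that] by (rule conjunct2)
    show "\<exists>a c. \<forall>x\<in>J. g x = a * x + c"
      if "g \<in> set (f # F)" "is_interval J" "J \<inter> (B \<union> B') = {}" for g J
      using that by (rule aff)
  qed
qed

section \<open>Cylinders and the attractor\<close>

lemma word_map_Nil [simp]: "word_map F [] = id"
  by (simp add: word_map_def)

lemma word_map_Cons [simp]: "word_map F (i # w) = F ! i \<circ> word_map F w"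
  by (simp add: word_map_def)

lemma word_map_append: "word_map F (u @ v) = word_map F u \<circ> word_map F v"
  by (induction u) (simp_all add: comp_assoc)

lemma cylinder_Nil [simp]: "cylinder F [] = base_interval F"
  by (simp add: cylinder_def)

lemma cylinder_append: "cylinder F (u @ v) = word_map F u ` cylinder F v"
  by (simp add: cylinder_def word_map_append image_comp)

lemma cylinder_Cons: "cylinder F (i # w) = F ! i ` cylinder F w"
  by (simp add: cylinder_def image_comp)

lemma finite_words: "finite (words F n)"
proof -
  have "words F n = {w. set w \<subseteq> {..<length F} \<and> length w = n}" by (auto simp: words_def)
  then show ?thesis using finite_lists_length_eq[of "{..<length F}" n] by simp
qed

lemma card_words: "card (words F n) = length F ^ n"
proof -
  have "words F n = {w. set w \<subseteq> {..<length F} \<and> length w = n}" by (auto simp: words_def)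
  then show ?thesis using card_lists_length_eq[of "{..<length F}" n] by simp
qed

lemma append_in_words: "u \<in> words F k \<Longrightarrow> v \<in> words F l \<Longrightarrow> u @ v \<in> words F (k + l)"
  by (auto simp: words_def)

text \<open>The hypotheses in the form in which they are used, with Lipschitz constants common to
  all maps and a common set of break points. Continuity and injectivity follow from the
  Lipschitz bounds.\<close>

locale separated_ifs =
  fixes F :: "(real \<Rightarrow> real) list" and \<rho> r :: real and B :: "real set"
  assumes F_nonempty: "F \<noteq> []"
    and \<rho>_pos: "0 < \<rho>" and r_less_1: "r < 1" and finite_B: "finite B"
    and lower_lipschitz: "f \<in> set F \<Longrightarrow> \<rho> * \<bar>x - y\<bar> \<le> \<bar>f x - f y\<bar>"
    and upper_lipschitz: "f \<in> set F \<Longrightarrow> \<bar>f x - f y\<bar> \<le> r * \<bar>x - y\<bar>"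
    and affine: "f \<in> set F \<Longrightarrow> is_interval J \<Longrightarrow> J \<inter> B = {} \<Longrightarrow> \<exists>a c. \<forall>x\<in>J. f x = a * x + c"
    and separated: "iosc F"
begin

abbreviation I :: "real set" where "I \<equiv> base_interval F"
abbreviation len :: "nat list \<Rightarrow> real" where "len w \<equiv> measure lborel (cylinder F w)"
abbreviation valid :: "nat list \<Rightarrow> bool" where "valid w \<equiv> set w \<subseteq> {..<length F}"

lemma \<rho>_le_r: "\<rho> \<le> r"
  using lower_lipschitz[of "F ! 0" 1 0] upper_lipschitz[of "F ! 0" 1 0] F_nonempty by simp

lemma r_pos: "0 < r" using \<rho>_le_r \<rho>_pos by simp

lemma word_map_upper: "valid w \<Longrightarrow> \<bar>word_map F w x - word_map F w y\<bar> \<le> r ^ length w * \<bar>x - y\<bar>"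
proof (induction w)
  case (Cons i w)
  have "\<bar>word_map F (i # w) x - word_map F (i # w) y\<bar> \<le> r * \<bar>word_map F w x - word_map F w y\<bar>"
    using Cons.prems upper_lipschitz[of "F ! i"] by simp
  also have "\<dots> \<le> r * (r ^ length w * \<bar>x - y\<bar>)"
    using Cons r_pos by (intro mult_left_mono) auto
  finally show ?case by simp
qed simp

lemma word_map_lower: "valid w \<Longrightarrow> \<rho> ^ length w * \<bar>x - y\<bar> \<le> \<bar>word_map F w x - word_map F w y\<bar>"
proof (induction w)
  case (Cons i w)
  have "\<rho> * (\<rho> ^ length w * \<bar>x - y\<bar>) \<le> \<rho> * \<bar>word_map F w x - word_map F w y\<bar>"
    using Cons \<rho>_pos by (intro mult_left_mono) auto
  also have "\<dots> \<le> \<bar>word_map F (i # w) x - word_map F (i # w) y\<bar>"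
    using Cons.prems lower_lipschitz[of "F ! i"] by simp
  finally show ?case by simp
qed simp

lemma inj_word_map: "valid w \<Longrightarrow> inj (word_map F w)"
proof (rule injI)
  fix x y assume *: "valid w" "word_map F w x = word_map F w y"
  show "x = y"
  proof (rule ccontr)
    assume "x \<noteq> y"
    then have "0 < \<rho> ^ length w * \<bar>x - y\<bar>" using \<rho>_pos by simp
    then show False using word_map_lower[OF *(1), of x y] *(2) by simp
  qed
qed

lemma continuous_word_map: "valid w \<Longrightarrow> continuous_on S (word_map F w)"
proof -
  assume w: "valid w"
  have "(r ^ length w)-lipschitz_on S (word_map F w)"
    using word_map_upper[OF w] r_pos by (intro lipschitz_onI) (auto simp: dist_real_def)
  then show ?thesis by (rule lipschitz_on_continuous_on)
qed

text \<open>A long interval around \<open>0\<close> is invariant, so the intersection is bounded. It is nonempty because every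
  nonempty invariant compact set contains the fixed point of the first map.\<close>

lemma base_interval_properties:
  "I \<noteq> {}" "compact I" "is_interval I" "\<And>f. f \<in> set F \<Longrightarrow> f ` I \<subseteq> I"
proof -
  define \<J> where "\<J> = {J. J \<noteq> {} \<and> compact J \<and> is_interval J \<and> (\<forall>f \<in> set F. f ` J \<subseteq> J)}"
  have I: "I = \<Inter>\<J>" by (simp add: base_interval_def \<J>_def)
  have F0: "F ! 0 \<in> set F" using F_nonempty by simp
  define M where "M = Max ((\<lambda>f. \<bar>f 0\<bar>) ` set F)"
  have M: "\<bar>f 0\<bar> \<le> M" if "f \<in> set F" for f using that by (simp add: M_def)
  have M0: "0 \<le> M" using M[OF F0] by linarith
  define R where "R = M / (1 - r)"
  have R: "M + r * R = R" "0 \<le> R" using M0 r_less_1 by (auto simp: R_def field_simps)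
  have "{-R..R} \<in> \<J>"
  proof -
    have "f x \<in> {-R..R}" if "f \<in> set F" "x \<in> {-R..R}" for f x
    proof -
      have "\<bar>f x\<bar> \<le> \<bar>f 0\<bar> + r * \<bar>x\<bar>" using upper_lipschitz[OF that(1), of x 0] by simp
      also have "\<dots> \<le> M + r * R" using M[OF that(1)] that(2) r_pos by (intro add_mono mult_left_mono) auto
      finally show ?thesis using R by auto
    qed
    then show ?thesis using R(2) by (simp add: \<J>_def image_subset_iff is_interval_cc)
  qed
  then have ne: "\<J> \<noteq> {}" by blast
  have fixpoint: "\<exists>p\<in>J. (F ! 0) p = p" if "J \<in> \<J>" for J
  proof -
    have J: "complete J" "J \<noteq> {}" "(F ! 0) ` J \<subseteq> J"
      using that F0 by (auto simp: \<J>_def compact_imp_complete)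
    have "\<exists>!p\<in>J. (F ! 0) p = p"
      by (rule Banach_fix[OF J(1,2) less_imp_le[OF r_pos] r_less_1 J(3)])
        (use upper_lipschitz[OF F0] in \<open>simp add: dist_real_def\<close>)
    then show ?thesis by blast
  qed
  obtain p where p: "(F ! 0) p = p" using fixpoint ne by blast
  have "p \<in> J" if J: "J \<in> \<J>" for J
  proof -
    obtain q where q: "q \<in> J" "(F ! 0) q = q" using fixpoint[OF J] by blast
    have "\<bar>p - q\<bar> * (1 - r) \<le> 0"
      using upper_lipschitz[OF F0, of p q] p q(2) by (simp add: algebra_simps)
    then have "p = q" using r_less_1 by (simp add: mult_le_0_iff)
    then show ?thesis using q(1) by simp
  qed
  then show "I \<noteq> {}" using I by blast
  have "closed I" unfolding I by (rule closed_Inter) (auto simp: \<J>_def compact_imp_closed)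
  moreover have "I \<subseteq> {-R..R}" using \<open>{-R..R} \<in> \<J>\<close> I by blast
  ultimately show "compact I" using compact_Int_closed[of "{-R..R}" I] by (simp add: Int_absorb1)
  show "is_interval I" unfolding I is_interval_1
  proof (intro ballI allI impI)
    fix a b x assume *: "a \<in> \<Inter>\<J>" "b \<in> \<Inter>\<J>" "a \<le> x \<and> x \<le> b"
    show "x \<in> \<Inter>\<J>"
    proof
      fix J assume J: "J \<in> \<J>"
      then have "is_interval J" "a \<in> J" "b \<in> J" using * by (auto simp: \<J>_def)
      then show "x \<in> J" using *(3) unfolding is_interval_1 by blast
    qed
  qed
  show "f ` I \<subseteq> I" if "f \<in> set F" for f
  proof -
    have "f ` I \<subseteq> J" if "J \<in> \<J>" for J
      using that \<open>f \<in> set F\<close> unfolding I \<J>_def by blast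
    then show ?thesis using I by blast
  qed
qed

definition lo :: real where "lo = (SOME a. \<exists>b. a \<le> b \<and> I = {a..b})"
definition hi :: real where "hi = (SOME b. lo \<le> b \<and> I = {lo..b})"

lemma lo_le_hi: "lo \<le> hi" and I_eq: "I = {lo..hi}"
proof -
  have "connected I \<and> compact I" using base_interval_properties is_interval_connected_1 by blast
  then have "\<exists>a b. I = {a..b}" using connected_compact_interval_1 by blast
  then have "\<exists>a b. a \<le> b \<and> I = {a..b}" using base_interval_properties(1) by force
  then have "\<exists>b. lo \<le> b \<and> I = {lo..b}" unfolding lo_def by (rule someI_ex)
  then have "lo \<le> hi \<and> I = {lo..hi}" unfolding hi_def by (rule someI_ex)
  then show "lo \<le> hi" "I = {lo..hi}" by blast+
qed

lemma cylinder_eq_segment: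
  assumes "valid w"
  shows "cylinder F w = closed_segment (word_map F w lo) (word_map F w hi)"
proof -
  have "I = closed_segment lo hi" using I_eq lo_le_hi by (simp add: closed_segment_eq_real_ivl)
  then show ?thesis unfolding cylinder_def
    using continuous_injective_image_segment_1[OF continuous_word_map[OF assms] inj_on_subset[OF inj_word_map[OF assms]]]
    by simp
qed

lemma len_eq: "valid w \<Longrightarrow> len w = \<bar>word_map F w hi - word_map F w lo\<bar>"
  by (simp add: cylinder_eq_segment closed_segment_eq_real_ivl)

lemma compact_cylinder: "valid w \<Longrightarrow> compact (cylinder F w)"
  by (simp add: cylinder_eq_segment)

lemma is_interval_cylinder: "valid w \<Longrightarrow> is_interval (cylinder F w)"
  by (simp add: cylinder_eq_segment is_interval_convex_1)

lemma cylinder_nonempty: "cylinder F w \<noteq> {}"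
  using base_interval_properties(1) by (simp add: cylinder_def)

lemma dist_le_len: "valid w \<Longrightarrow> x \<in> cylinder F w \<Longrightarrow> y \<in> cylinder F w \<Longrightarrow> \<bar>x - y\<bar> \<le> len w"
  by (auto simp: len_eq cylinder_eq_segment closed_segment_eq_real_ivl split: if_splits)

lemma diameter_cylinder_le: "valid w \<Longrightarrow> diameter (cylinder F w) \<le> len w"
  using cylinder_nonempty dist_le_len by (intro diameter_le) auto

lemma len_append_upper: "valid u \<Longrightarrow> valid v \<Longrightarrow> len (u @ v) \<le> r ^ length u * len v"
  using word_map_upper[of u] by (simp add: len_eq word_map_append)

lemma len_append_lower: "valid u \<Longrightarrow> valid v \<Longrightarrow> \<rho> ^ length u * len v \<le> len (u @ v)"
  using word_map_lower[of u] by (simp add: len_eq word_map_append)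

lemma len_upper: "valid w \<Longrightarrow> len w \<le> r ^ length w * len []"
  using len_append_upper[of w "[]"] by simp

lemma len_lower: "valid w \<Longrightarrow> \<rho> ^ length w * len [] \<le> len w"
  using len_append_lower[of w "[]"] by simp

lemma word_map_I: "valid w \<Longrightarrow> word_map F w ` I \<subseteq> I"
proof (induction w)
  case (Cons i w)
  then have "word_map F w ` I \<subseteq> I" "(F ! i) ` I \<subseteq> I" using base_interval_properties(4)[of "F ! i"] by auto
  then show ?case by (auto simp: image_subset_iff)
qed simp

lemma cylinder_append_subset: "valid v \<Longrightarrow> cylinder F (u @ v) \<subseteq> cylinder F u"
  unfolding cylinder_append unfolding cylinder_def by (intro image_mono word_map_I)

lemma cylinder_subset_I: "valid v \<Longrightarrow> cylinder F v \<subseteq> I"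
  using cylinder_append_subset[of v "[]"] by simp

lemma cylinder_Cons_disjoint:
  assumes "valid (i # u)" "valid (j # v)" "i \<noteq> j"
  shows "cylinder F (i # u) \<inter> cylinder F (j # v) = {}"
proof -
  have "cylinder F [i] \<inter> cylinder F [j] = {}"
    using separated assms by (simp add: iosc_def)
  then show ?thesis
    using cylinder_append_subset[of u "[i]"] cylinder_append_subset[of v "[j]"] assms by auto
qed

lemma cylinder_disjoint:
  assumes "u \<in> words F n" "v \<in> words F n" "u \<noteq> v"
  shows "cylinder F u \<inter> cylinder F v = {}"
  using assms
proof (induction n arbitrary: u v)
  case (Suc n)
  obtain i u' j v' where uv: "u = i # u'" "v = j # v'"
    using Suc.prems by (cases u; cases v) (auto simp: words_def)
  show ?case
  proof (cases "i = j")
    case True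
    have "cylinder F u' \<inter> cylinder F v' = {}"
      using Suc True uv by (intro Suc.IH) (auto simp: words_def)
    moreover have "inj (F ! i)" using inj_word_map[of "[i]"] Suc.prems uv by (auto simp: words_def)
    ultimately show ?thesis
      using True uv by (simp add: cylinder_Cons flip: image_Int)
  next
    case False
    then show ?thesis using cylinder_Cons_disjoint[of i u' j v'] Suc.prems uv by (auto simp: words_def)
  qed
qed (simp add: words_def)

lemma unique_word:
  "u \<in> words F n \<Longrightarrow> v \<in> words F n \<Longrightarrow> x \<in> cylinder F u \<Longrightarrow> x \<in> cylinder F v \<Longrightarrow> u = v"
  using cylinder_disjoint by blast

lemma F_eq_image: "set F = (!) F ` {..<length F}"
  by (auto simp: set_conv_nth)

lemma invariant_eq_Union_words:
  assumes "K = (\<Union>f\<in>set F. f ` K)"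
  shows "K = (\<Union>w\<in>words F n. word_map F w ` K)"
proof (induction n)
  case 0
  show ?case by (simp add: words_def)
next
  case (Suc n)
  have "words F (Suc n) = (\<Union>i<length F. (#) i ` words F n)"
    by (auto simp: words_def length_Suc_conv)
  then have "(\<Union>w\<in>words F (Suc n). word_map F w ` K) = (\<Union>i<length F. \<Union>w\<in>words F n. (F ! i) ` word_map F w ` K)"
    by (simp add: image_comp UN_UN_flatten)
  also have "\<dots> = (\<Union>i<length F. (F ! i) ` (\<Union>w\<in>words F n. word_map F w ` K))"
    by (simp add: image_UN)
  also have "\<dots> = (\<Union>i<length F. (F ! i) ` K)"
    by (simp only: Suc[symmetric])
  also have "\<dots> = K" using assms by (simp add: F_eq_image)
  finally show ?case by simp
qed

text \<open>Both sets are unions of their images under the words of length \<open>n\<close>, and a word of length \<open>n\<close> brings any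
  two points within \<open>r ^ n\<close> times their distance; so each point of \<open>K\<close> is a limit of points of \<open>L\<close>.\<close>

lemma invariant_subset:
  assumes K: "K \<noteq> {}" "compact K" "K = (\<Union>f\<in>set F. f ` K)"
    and L: "L \<noteq> {}" "compact L" "L = (\<Union>f\<in>set F. f ` L)"
  shows "K \<subseteq> L"
proof
  fix x assume x: "x \<in> K"
  obtain y where y: "y \<in> L" using L(1) by blast
  have "bounded (insert y K)" using K(2) compact_imp_bounded by auto
  then obtain D where D: "\<And>a b. a \<in> insert y K \<Longrightarrow> b \<in> insert y K \<Longrightarrow> dist a b \<le> D"
    using bounded_two_points[of "insert y K"] by blast
  have "\<exists>z\<in>L. dist z x < e" if e: "0 < e" for e
  proof -
    have "(\<lambda>n. r ^ n * D) \<longlonglongrightarrow> 0 * D" using r_pos r_less_1 by (intro tendsto_intros LIMSEQ_realpow_zero) auto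
    then have "eventually (\<lambda>n. r ^ n * D < e) sequentially" using e by (intro order_tendstoD(2)) auto
    then obtain n where n: "r ^ n * D < e" using eventually_happens'[OF sequentially_bot] by blast
    obtain w k where w: "w \<in> words F n" "k \<in> K" "x = word_map F w k"
      using x invariant_eq_Union_words[OF K(3), of n] by blast
    have "word_map F w y \<in> L" using invariant_eq_Union_words[OF L(3), of n] w(1) y by blast
    moreover have "dist (word_map F w y) x \<le> r ^ n * D"
    proof -
      have "dist (word_map F w y) x \<le> r ^ n * \<bar>y - k\<bar>"
        using word_map_upper[of w y k] w by (simp add: words_def dist_real_def)
      also have "\<dots> \<le> r ^ n * D"
        using D[of y k] w(2) r_pos by (intro mult_left_mono) (simp_all add: dist_real_def)
      finally show ?thesis .
    qed
    ultimately show ?thesis using n by force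
  qed
  then have "x \<in> closure L" by (simp add: closure_approachable)
  then show "x \<in> L" using L(2) by (simp add: compact_imp_closed)
qed

definition level :: "nat \<Rightarrow> real set" where
  "level n = (\<Union>w\<in>words F n. cylinder F w)"

lemma level_Suc: "level (Suc n) = (\<Union>i<length F. (F ! i) ` level n)"
proof -
  have "words F (Suc n) = (\<Union>i<length F. (#) i ` words F n)"
    by (auto simp: words_def length_Suc_conv)
  then show ?thesis by (auto simp: level_def cylinder_Cons)
qed

lemma compact_level: "compact (level n)"
  unfolding level_def by (intro compact_UN finite_words compact_cylinder) (auto simp: words_def)

lemma level_Suc_subset: "level (Suc n) \<subseteq> level n"
proof (induction n)
  case 0
  show ?case using cylinder_subset_I unfolding level_def by (auto simp: words_def)
next
  case (Suc n)
  then show ?case unfolding level_Suc[of "Suc n"] level_Suc[of n] by blast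
qed

lemma level_nonempty: "level n \<noteq> {}"
proof -
  have "replicate n 0 \<in> words F n" using F_nonempty by (auto simp: words_def)
  then show ?thesis using cylinder_nonempty unfolding level_def by blast
qed

text \<open>A point of the intersection has a preimage in each level. By the disjointness of the first cylinders
  and by injectivity, it is the same preimage for all levels.\<close>

lemma Inter_level_invariant:
  "(\<Inter>n. level n) = (\<Union>f\<in>set F. f ` (\<Inter>n. level n))"
proof
  show "(\<Union>f\<in>set F. f ` (\<Inter>n. level n)) \<subseteq> (\<Inter>n. level n)"
  proof -
    have "(F ! i) x \<in> level n" if "i < length F" "\<And>n. x \<in> level n" for i x n
      using that level_Suc[of n] level_Suc_subset[of n] by blast
    then show ?thesis by (auto simp: F_eq_image)
  qed
  show "(\<Inter>n. level n) \<subseteq> (\<Union>f\<in>set F. f ` (\<Inter>n. level n))"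
  proof
    fix x assume "x \<in> (\<Inter>n. level n)"
    then have x: "x \<in> level n" for n by blast
    obtain i y where i: "i < length F" "x = (F ! i) y" "y \<in> I"
      using x[of "Suc 0"] unfolding level_Suc by (auto simp: level_def words_def)
    have "y \<in> level n" for n
    proof -
      obtain j z where j: "j < length F" "x = (F ! j) z" "z \<in> level n"
        using x[of "Suc n"] unfolding level_Suc by blast
      have "z \<in> I" using j(3) cylinder_subset_I unfolding level_def by (auto simp: words_def)
      then have "x \<in> cylinder F [i] \<inter> cylinder F [j]"
        using i(2,3) j(2) \<open>z \<in> I\<close> unfolding cylinder_Cons cylinder_Nil by blast
      then have "i = j" using separated[unfolded iosc_def, rule_format, OF i(1) j(1)] by auto
      then have "(F ! i) y = (F ! i) z" using i(2) j(2) by simp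
      moreover have "inj (F ! i)" using inj_word_map[of "[i]"] i(1) by simp
      ultimately have "y = z" by (rule injD[rotated])
      then show ?thesis using j(3) by simp
    qed
    then show "x \<in> (\<Union>f\<in>set F. f ` (\<Inter>n. level n))" using i by (auto simp: F_eq_image)
  qed
qed

lemma attractor_eq: "attractor F = (\<Inter>n. level n)"
  and attractor_nonempty: "attractor F \<noteq> {}"
  and compact_attractor: "compact (attractor F)"
  and attractor_invariant: "attractor F = (\<Union>f\<in>set F. f ` attractor F)"
proof -
  have "level n \<subseteq> level m" if "m \<le> n" for m n
    using that lift_Suc_antimono_le[of level] level_Suc_subset by blast
  then have ne: "(\<Inter>n. level n) \<noteq> {}"
    using compact_nest[of level] compact_level level_nonempty by blast
  have "closed (\<Inter>n. level n)" by (intro closed_INT) (simp add: compact_level compact_imp_closed)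
  then have "compact (level 0 \<inter> (\<Inter>n. level n))" using compact_level by (intro compact_Int_closed)
  moreover have "level 0 \<inter> (\<Inter>n. level n) = (\<Inter>n. level n)" by blast
  ultimately have c: "compact (\<Inter>n. level n)" by simp
  show eq: "attractor F = (\<Inter>n. level n)"
    unfolding attractor_def
  proof (rule the_equality)
    show "(\<Inter>n. level n) \<noteq> {} \<and> compact (\<Inter>n. level n) \<and>
        (\<Inter>n. level n) = (\<Union>f\<in>set F. f ` (\<Inter>n. level n))"
      using ne c Inter_level_invariant by (intro conjI)
    fix K assume *: "K \<noteq> {} \<and> compact K \<and> K = (\<Union>f\<in>set F. f ` K)"
    note K = conjunct1[OF *] conjunct1[OF conjunct2[OF *]] conjunct2[OF conjunct2[OF *]]
    show "K = (\<Inter>n. level n)"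
      by (rule equalityI[OF invariant_subset[OF K ne c Inter_level_invariant]
            invariant_subset[OF ne c Inter_level_invariant K]])
  qed
  show "attractor F \<noteq> {}" unfolding eq by (rule ne)
  show "compact (attractor F)" unfolding eq by (rule c)
  show "attractor F = (\<Union>f\<in>set F. f ` attractor F)" unfolding eq by (rule Inter_level_invariant)
qed

lemma word_map_attractor:
  assumes "w \<in> words F n"
  shows "word_map F w ` attractor F \<subseteq> attractor F"
proof -
  have "word_map F w ` attractor F \<subseteq> (\<Union>w\<in>words F n. word_map F w ` attractor F)"
    using assms by (rule UN_upper)
  also have "\<dots> = attractor F" by (rule invariant_eq_Union_words[OF attractor_invariant, symmetric])
  finally show ?thesis .
qed

lemma attractor_subset_I: "attractor F \<subseteq> I"
proof -
  have "level 0 = I" by (simp add: level_def words_def)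
  then show ?thesis using attractor_eq by blast
qed

end

section \<open>Coverings, Hausdorff measure and box dimension\<close>

lemma rpow_nonneg: "0 \<le> rpow x s"
  by (simp add: rpow_def)

lemma rpow_mono: "0 \<le> s \<Longrightarrow> 0 \<le> x \<Longrightarrow> x \<le> y \<Longrightarrow> rpow x s \<le> rpow y s"
  by (simp add: rpow_def powr_mono2)

lemma rpow_eq_powr: "0 < x \<Longrightarrow> rpow x s = x powr s"
  by (simp add: rpow_def)

text \<open>The definition asks for a sequence of sets; a finite cover is padded with empty sets.\<close>

lemma premeasure_le_finite_cover:
  assumes "finite A" "K \<subseteq> (\<Union>a\<in>A. C a)" "\<And>a. a \<in> A \<Longrightarrow> bounded (C a) \<and> diameter (C a) \<le> \<delta>" "0 \<le> \<delta>"
  shows "hausdorff_premeasure s \<delta> K \<le> ennreal (\<Sum>a\<in>A. rpow (diameter (C a)) s)"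
proof -
  obtain h where h: "bij_betw h {0..<card A} A" using ex_bij_betw_nat_finite[OF assms(1)] by blast
  define U where "U i = (if i < card A then C (h i) else {})" for i
  have hA: "h i \<in> A" if "i < card A" for i using h that by (auto simp: bij_betw_def)
  have "K \<subseteq> (\<Union>i. U i)"
  proof
    fix x assume "x \<in> K"
    then obtain a where a: "a \<in> A" "x \<in> C a" using assms(2) by blast
    moreover have "a \<in> h ` {0..<card A}" using h a(1) by (simp add: bij_betw_def)
    ultimately obtain i where "i < card A" "a = h i" by auto
    then have "x \<in> U i" using a by (simp add: U_def)
    then show "x \<in> (\<Union>i. U i)" by blast
  qed
  moreover have "bounded (U i) \<and> diameter (U i) \<le> \<delta>" for i
    using assms(3)[OF hA] assms(4) by (simp add: U_def)
  ultimately have "hausdorff_premeasure s \<delta> K \<le> (\<Sum>i. if U i = {} then 0 else ennreal (rpow (diameter (U i)) s))"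
    unfolding hausdorff_premeasure_def by (intro INF_lower) simp
  also have "\<dots> = (\<Sum>i\<in>{0..<card A}. if U i = {} then 0 else ennreal (rpow (diameter (U i)) s))"
    by (rule suminf_finite) (auto simp: U_def)
  also have "\<dots> \<le> (\<Sum>i\<in>{0..<card A}. ennreal (rpow (diameter (C (h i))) s))"
    by (rule sum_mono) (simp add: U_def)
  also have "\<dots> = (\<Sum>a\<in>A. ennreal (rpow (diameter (C a)) s))"
    by (rule sum.reindex_bij_betw[OF h])
  also have "\<dots> = ennreal (\<Sum>a\<in>A. rpow (diameter (C a)) s)"
    by (rule sum_ennreal) (rule rpow_nonneg)
  finally show ?thesis .
qed

lemma hausdorff_measure_0_nonempty:
  fixes A :: "'a::metric_space set"
  assumes "A \<noteq> {}"
  shows "hausdorff_measure 0 A \<noteq> 0"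
proof -
  have "1 \<le> hausdorff_premeasure 0 1 A"
    unfolding hausdorff_premeasure_def
  proof (rule INF_greatest)
    fix U :: "nat \<Rightarrow> 'a set"
    assume "U \<in> {U. A \<subseteq> (\<Union>i. U i) \<and> (\<forall>i. bounded (U i) \<and> diameter (U i) \<le> 1)}"
    then obtain i where i: "U i \<noteq> {}" using assms by blast
    let ?f = "\<lambda>i. if U i = {} then 0 else ennreal (rpow (diameter (U i)) 0)"
    have "1 = (\<Sum>j\<in>{i}. ?f j)" using i by (simp add: rpow_def)
    also have "\<dots> \<le> suminf ?f" by (rule sum_le_suminf) simp_all
    finally show "1 \<le> suminf ?f" .
  qed
  also have "\<dots> \<le> hausdorff_measure 0 A"
    unfolding hausdorff_measure_def by (rule SUP_upper) simp
  finally show ?thesis by auto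
qed

lemma covering_number_le:
  assumes "finite C" "A \<subseteq> \<Union>C" "\<And>U. U \<in> C \<Longrightarrow> bounded U \<and> diameter U \<le> \<delta>"
  shows "covering_number \<delta> A \<le> card C"
  unfolding covering_number_def using assms by (intro Least_le exI[of _ C]) simp

lemma covering_number_cover:
  assumes "finite C" "A \<subseteq> \<Union>C" "\<And>U. U \<in> C \<Longrightarrow> bounded U \<and> diameter U \<le> \<delta>"
  shows "\<exists>D. finite D \<and> card D = covering_number \<delta> A \<and> A \<subseteq> \<Union>D \<and> (\<forall>U\<in>D. bounded U \<and> diameter U \<le> \<delta>)"
proof -
  define P where "P n \<longleftrightarrow> (\<exists>C. finite C \<and> card C = n \<and> A \<subseteq> \<Union>C \<and> (\<forall>U\<in>C. bounded U \<and> diameter U \<le> \<delta>))" for n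
  have "P (card C)" unfolding P_def using assms by (intro exI[of _ C]) simp
  then have "P (LEAST n. P n)" by (rule LeastI)
  then have "P (covering_number \<delta> A)" by (simp add: covering_number_def P_def)
  then show ?thesis unfolding P_def .
qed

text \<open>Constant factors in the counting bounds vanish in the limit after division by \<open>- ln \<delta>\<close>.\<close>

lemma has_box_dimI:
  fixes A :: "'a::metric_space set"
  assumes upper: "\<And>s. d < s \<Longrightarrow> \<exists>C>0. \<forall>\<delta>\<in>{0<..<1}. real (covering_number \<delta> A) \<le> C * \<delta> powr (-s)"
    and lower: "\<And>s. s < d \<Longrightarrow> \<exists>c>0. \<forall>\<delta>\<in>{0<..<1}. c * \<delta> powr (-s) \<le> real (covering_number \<delta> A)"
    and pos: "\<And>\<delta>. \<delta> \<in> {0<..<1} \<Longrightarrow> 0 < covering_number \<delta> A"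
  shows "has_box_dim A d"
proof -
  have lim: "((\<lambda>\<delta>. s + ln C / - ln \<delta>) \<longlongrightarrow> s) (at_right 0)" for s C :: real
  proof -
    have "filterlim (\<lambda>\<delta>::real. - ln \<delta>) at_top (at_right 0)"
      using ln_at_0 by (simp add: filterlim_uminus_at_top)
    then have "((\<lambda>\<delta>. ln C / - ln \<delta>) \<longlongrightarrow> 0) (at_right 0)"
      by (intro tendsto_divide_0[OF tendsto_const] filterlim_at_top_imp_at_infinity)
    then have "((\<lambda>\<delta>. s + ln C / - ln \<delta>) \<longlongrightarrow> s + 0) (at_right 0)" by (intro tendsto_add tendsto_const)
    then show ?thesis by simp
  qed
  have ev: "eventually (\<lambda>\<delta>::real. \<delta> \<in> {0<..<1}) (at_right 0)"
    by (rule eventually_at_right_real) simp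
  have ratio: "ln (C * \<delta> powr (-s)) / - ln \<delta> = s + ln C / - ln \<delta>" "0 < - ln \<delta>"
    if "0 < C" "\<delta> \<in> {0<..<1}" for C \<delta> s :: real
    using that by (simp_all add: ln_mult ln_powr field_simps)
  show ?thesis
    unfolding has_box_dim_def
  proof (rule order_tendstoI)
    fix a assume "a < d"
    then obtain s where s: "a < s" "s < d" using dense by blast
    obtain c where c: "0 < c" "\<And>\<delta>. \<delta> \<in> {0<..<1} \<Longrightarrow> c * \<delta> powr (-s) \<le> real (covering_number \<delta> A)"
      using lower[OF s(2)] by blast
    have "eventually (\<lambda>\<delta>. a < s + ln c / - ln \<delta>) (at_right 0)"
      using order_tendstoD(1)[OF lim s(1)] .
    then show "eventually (\<lambda>\<delta>. a < ln (real (covering_number \<delta> A)) / - ln \<delta>) (at_right 0)"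
      using ev
    proof eventually_elim
      case (elim \<delta>)
      have "ln (c * \<delta> powr (-s)) \<le> ln (real (covering_number \<delta> A))"
        using c elim(2) by (intro ln_mono) auto
      then have "ln (c * \<delta> powr (-s)) / - ln \<delta> \<le> ln (real (covering_number \<delta> A)) / - ln \<delta>"
        using ratio(2)[OF c(1) elim(2)] by (intro divide_right_mono) auto
      then show ?case using ratio(1)[OF c(1) elim(2), of s] elim(1) by linarith
    qed
  next
    fix a assume "d < a"
    then obtain s where s: "s < a" "d < s" using dense by blast
    obtain C where C: "0 < C" "\<And>\<delta>. \<delta> \<in> {0<..<1} \<Longrightarrow> real (covering_number \<delta> A) \<le> C * \<delta> powr (-s)"
      using upper[OF s(2)] by blast
    have "eventually (\<lambda>\<delta>. s + ln C / - ln \<delta> < a) (at_right 0)"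
      using order_tendstoD(2)[OF lim s(1)] .
    then show "eventually (\<lambda>\<delta>. ln (real (covering_number \<delta> A)) / - ln \<delta> < a) (at_right 0)"
      using ev
    proof eventually_elim
      case (elim \<delta>)
      have "ln (real (covering_number \<delta> A)) \<le> ln (C * \<delta> powr (-s))"
        using C elim(2) pos[OF elim(2)] by (intro ln_mono) auto
      then have "ln (real (covering_number \<delta> A)) / - ln \<delta> \<le> ln (C * \<delta> powr (-s)) / - ln \<delta>"
        using ratio(2)[OF C(1) elim(2)] by (intro divide_right_mono) auto
      then show ?case using ratio(1)[OF C(1) elim(2), of s] elim(1) by linarith
    qed
  qed
qed

context separated_ifs
begin

section \<open>The natural pressure\<close>

definition cylinder_sum :: "real \<Rightarrow> nat \<Rightarrow> real" where
  "cylinder_sum s n = (\<Sum>w\<in>words F n. rpow (len w) s)"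

lemma cylinder_sum_nonneg: "0 \<le> cylinder_sum s n"
  unfolding cylinder_sum_def by (intro sum_nonneg rpow_nonneg)

lemma natural_pressure_eq: "natural_pressure F s = limsup (\<lambda>n. ereal (1 / real n) * elog (cylinder_sum s n))"
  by (simp add: natural_pressure_def cylinder_sum_def)

text \<open>The inequality also covers vanishing sums, whose extended logarithm is \<open>-\<infinity>\<close>.\<close>

lemma geometric_bound_of_pressure_neg:
  assumes "natural_pressure F s < 0"
  obtains \<theta> where "0 < \<theta>" "\<theta> < 1" "eventually (\<lambda>n. cylinder_sum s n \<le> \<theta> ^ n) sequentially"
proof -
  obtain c where c: "natural_pressure F s < ereal c" "ereal c < 0" using ereal_dense2[OF assms] by blast
  have "eventually (\<lambda>n. ereal (1 / real n) * elog (cylinder_sum s n) < ereal c) sequentially"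
    using c(1) unfolding natural_pressure_eq by (rule Limsup_lessD)
  then have "eventually (\<lambda>n. cylinder_sum s n \<le> exp c ^ n) sequentially"
    using eventually_gt_at_top[of 0]
  proof eventually_elim
    case (elim n)
    show ?case
    proof (cases "cylinder_sum s n \<le> 0")
      case True
      then show ?thesis by (rule order_trans) simp
    next
      case False
      then have "ln (cylinder_sum s n) / real n < c" using elim by (simp add: elog_def)
      then have "ln (cylinder_sum s n) < real n * c" using elim(2) by (simp add: field_simps)
      then have "cylinder_sum s n < exp (real n * c)" using False exp_less_mono[of "ln (cylinder_sum s n)" "real n * c"] by simp
      then show ?thesis by (simp add: exp_of_nat_mult)
    qed
  qed
  then show thesis using c(2) by (intro that[of "exp c"]) auto
qed

lemma summable_of_pressure_neg:
  assumes "natural_pressure F s < 0"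
  shows "summable (cylinder_sum s)"
proof -
  obtain \<theta> where \<theta>: "0 < \<theta>" "\<theta> < 1" "eventually (\<lambda>n. cylinder_sum s n \<le> \<theta> ^ n) sequentially"
    using geometric_bound_of_pressure_neg[OF assms] .
  have "eventually (\<lambda>n. norm (cylinder_sum s n) \<le> \<theta> ^ n) sequentially"
    using \<theta>(3) by (simp add: cylinder_sum_nonneg)
  then show ?thesis
    using \<theta>(1,2) by (intro summable_comparison_test_ev[OF _ summable_geometric]) auto
qed

lemma len_tendsto_0: "0 < \<delta> \<Longrightarrow> eventually (\<lambda>n. r ^ n * len [] < \<delta>) sequentially"
proof -
  assume \<delta>: "0 < \<delta>"
  have "(\<lambda>n. r ^ n * len []) \<longlonglongrightarrow> 0 * len []"
    using r_pos r_less_1 by (intro tendsto_mult tendsto_const LIMSEQ_realpow_zero) auto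
  then show ?thesis using \<delta> by (intro order_tendstoD(2)) auto
qed

lemma len_word_upper: "w \<in> words F n \<Longrightarrow> len w \<le> r ^ n * len []"
  using len_upper[of w] by (simp add: words_def)

lemma attractor_subset_level: "attractor F \<subseteq> (\<Union>w\<in>words F n. cylinder F w)"
  using attractor_eq level_def by blast

lemma word_cylinder_bounded: "w \<in> words F n \<Longrightarrow> bounded (cylinder F w)"
  using compact_cylinder by (auto simp: words_def compact_imp_bounded)

lemma word_cylinder_diameter: "w \<in> words F n \<Longrightarrow> diameter (cylinder F w) \<le> len w"
  using diameter_cylinder_le by (auto simp: words_def)

lemma hausdorff_measure_eq_0:
  assumes "natural_pressure F s < 0" "0 \<le> s"
  shows "hausdorff_measure s (attractor F) = 0"
proof -
  have "hausdorff_premeasure s \<delta> (attractor F) = 0" if \<delta>: "0 < \<delta>" for \<delta>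
  proof (rule antisym[OF ennreal_le_epsilon])
    fix e :: real assume e: "0 < e"
    have "cylinder_sum s \<longlonglongrightarrow> 0" using summable_of_pressure_neg[OF assms(1)] by (rule summable_LIMSEQ_zero)
    then have "eventually (\<lambda>n. cylinder_sum s n < e) sequentially" using e by (rule order_tendstoD)
    then have "eventually (\<lambda>n. cylinder_sum s n < e \<and> r ^ n * len [] < \<delta>) sequentially"
      using len_tendsto_0[OF \<delta>] by (rule eventually_conj)
    then obtain n where n: "cylinder_sum s n < e" "r ^ n * len [] < \<delta>"
      using eventually_happens'[OF sequentially_bot] by blast
    have "diameter (cylinder F w) \<le> \<delta>" if "w \<in> words F n" for w
      using word_cylinder_diameter[OF that] len_word_upper[OF that] n(2) by linarith
    then have "hausdorff_premeasure s \<delta> (attractor F) \<le> ennreal (\<Sum>w\<in>words F n. rpow (diameter (cylinder F w)) s)"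
      using \<delta> word_cylinder_bounded
      by (intro premeasure_le_finite_cover finite_words attractor_subset_level) auto
    also have "\<dots> \<le> ennreal (cylinder_sum s n)"
      unfolding cylinder_sum_def using assms(2) word_cylinder_diameter word_cylinder_bounded
      by (intro ennreal_leI sum_mono rpow_mono diameter_ge_0)
    also have "\<dots> \<le> ennreal e" using n(1) by (intro ennreal_leI) simp
    finally show "hausdorff_premeasure s \<delta> (attractor F) \<le> 0 + ennreal e" by simp
  qed simp
  then show ?thesis by (simp add: hausdorff_measure_def)
qed

lemma finite_cover_exists:
  assumes "0 < \<delta>"
  shows "\<exists>D. finite D \<and> card D = covering_number \<delta> (attractor F) \<and> attractor F \<subseteq> \<Union>D \<and>
    (\<forall>U\<in>D. bounded U \<and> diameter U \<le> \<delta>)"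
proof -
  obtain n where n: "r ^ n * len [] < \<delta>"
    using eventually_happens'[OF sequentially_bot len_tendsto_0[OF assms]] by blast
  have "diameter (cylinder F w) \<le> \<delta>" if "w \<in> words F n" for w
    using word_cylinder_diameter[OF that] len_word_upper[OF that] n by linarith
  then have small: "bounded U \<and> diameter U \<le> \<delta>" if "U \<in> cylinder F ` words F n" for U
    using that word_cylinder_bounded by auto
  show ?thesis
    by (rule covering_number_cover[OF finite_imageI[OF finite_words[of F n]] attractor_subset_level[of n]])
      (rule small)
qed

lemma covering_number_pos:
  assumes "0 < \<delta>"
  shows "0 < covering_number \<delta> (attractor F)"
proof -
  obtain D where "finite D" "card D = covering_number \<delta> (attractor F)" "attractor F \<subseteq> \<Union>D"
    using finite_cover_exists[OF assms] by blast
  then show ?thesis using attractor_nonempty by (metis Union_empty card_gt_0_iff subset_empty)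
qed

text \<open>Follow a point of the attractor through its cylinders up to the first one of length at most \<open>\<delta>\<close>:
  it is a child of a cylinder longer than \<open>\<delta>\<close>. The number of those is at most \<open>\<delta>\<^sup>-\<^sup>s\<close> times the
  sum of all cylinder sums. Stopping cylinders are counted through their parents because a child
  can be arbitrarily short in comparison with its parent. If the base interval is itself short,
  it is used as a cover of one set.\<close>

lemma covering_number_upper:
  assumes "natural_pressure F s < 0" "0 \<le> s"
  shows "\<exists>C>0. \<forall>\<delta>\<in>{0<..<1}. real (covering_number \<delta> (attractor F)) \<le> C * \<delta> powr (-s)"
proof -
  define m where "m = length F"
  define K where "K = suminf (cylinder_sum s)"
  have K: "(\<Sum>n<N. cylinder_sum s n) \<le> K" for N
    unfolding K_def using summable_of_pressure_neg[OF assms(1)] cylinder_sum_nonneg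
    by (intro sum_le_suminf) auto
  then have K0: "0 \<le> K" using K[of 0] by simp
  have "real (covering_number \<delta> (attractor F)) \<le> (1 + m * K) * \<delta> powr (-s)" if \<delta>: "\<delta> \<in> {0<..<1}" for \<delta>
  proof -
    have one: "1 \<le> \<delta> powr (-s)"
    proof -
      have "\<delta> powr s \<le> 1" using \<delta> assms(2) by (intro powr_le1) auto
      then show ?thesis using \<delta> by (simp add: powr_minus one_le_inverse_iff)
    qed
    obtain N where N: "r ^ N * len [] < \<delta>"
      using eventually_happens'[OF sequentially_bot len_tendsto_0] \<delta> by auto
    define W where "W n = {w\<in>words F n. \<delta> < len w}" for n
    define X where "X = (\<Union>n<N. W n)"
    have finW: "finite (W n)" for n using finite_words[of F n] by (simp add: W_def)
    have cardW: "real (card (W n)) * \<delta> powr s \<le> cylinder_sum s n" for n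
    proof -
      have "real (card (W n)) * \<delta> powr s = (\<Sum>w\<in>W n. rpow \<delta> s)"
        using \<delta> by (simp add: rpow_eq_powr)
      also have "\<dots> \<le> (\<Sum>w\<in>W n. rpow (len w) s)"
        using \<delta> assms(2) by (intro sum_mono rpow_mono) (auto simp: W_def)
      also have "\<dots> \<le> cylinder_sum s n"
        unfolding cylinder_sum_def using finite_words by (intro sum_mono2 rpow_nonneg) (auto simp: W_def)
      finally show ?thesis .
    qed
    have "real (card X) * \<delta> powr s \<le> (\<Sum>n<N. real (card (W n))) * \<delta> powr s"
      using card_UN_le[of "{..<N}" W] by (intro mult_right_mono) (simp_all add: X_def flip: of_nat_sum)
    also have "\<dots> \<le> (\<Sum>n<N. cylinder_sum s n)"
      unfolding sum_distrib_right by (intro sum_mono cardW)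
    finally have "real (card X) * \<delta> powr s \<le> K" using K[of N] by linarith
    then have cardX: "real (card X) \<le> K * \<delta> powr (-s)"
      using \<delta> by (simp add: powr_minus field_simps)
    define Y where "Y = {(w, i). w \<in> X \<and> i < m \<and> len (w @ [i]) \<le> \<delta>}"
    have Y: "Y \<subseteq> X \<times> {..<m}" by (auto simp: Y_def)
    have finX: "finite X" using finW by (simp add: X_def)
    define c where "c = (\<lambda>(w, i). cylinder F (w @ [i]))"
    define D where "D = (if len [] \<le> \<delta> then {I} else c ` Y)"
    have finY: "finite Y" using finX by (intro finite_subset[OF Y]) simp
    have "attractor F \<subseteq> \<Union>D"
    proof (cases "len [] \<le> \<delta>")
      case True
      then show ?thesis using attractor_subset_I by (simp add: D_def)
    next
      case False
      show ?thesis
      proof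
        fix x assume "x \<in> attractor F"
        then obtain w where w: "w \<in> words F N" "x \<in> cylinder F w"
          using attractor_subset_level[of N] by blast
        have "len w \<le> \<delta>" using len_word_upper[OF w(1)] N by linarith
        moreover have lw: "length w = N" "valid w" using w(1) by (auto simp: words_def)
        ultimately have ex: "len (take N w) \<le> \<delta>" by simp
        define k where "k = (LEAST k. len (take k w) \<le> \<delta>)"
        have k: "len (take k w) \<le> \<delta>" unfolding k_def using ex by (rule LeastI)
        have kN: "k \<le> N" unfolding k_def using ex by (rule Least_le)
        have "k \<noteq> 0" using k False by (metis take0)
        then obtain j where j: "k = Suc j" by (cases k) auto
        have "\<delta> < len (take j w)" using not_less_Least[of j "\<lambda>k. len (take k w) \<le> \<delta>"] j by (simp add: k_def)
        moreover have "take j w \<in> words F j" using lw j kN set_take_subset[of j w] by (auto simp: words_def)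
        ultimately have "take j w \<in> X" using j kN by (auto simp: X_def W_def)
        moreover have eq: "take k w = take j w @ [w ! j]" using j kN lw by (simp add: take_Suc_conv_app_nth)
        moreover have "w ! j < m" using lw j kN by (auto simp: m_def subset_iff)
        ultimately have "(take j w, w ! j) \<in> Y" using k by (simp add: Y_def)
        moreover have "cylinder F w \<subseteq> cylinder F (take k w)"
          using cylinder_append_subset[of "drop k w" "take k w"] lw set_drop_subset[of k w] by auto
        then have "x \<in> c (take j w, w ! j)" using w(2) eq by (auto simp: c_def)
        ultimately show "x \<in> \<Union>D" using False by (auto simp: D_def)
      qed
    qed
    moreover have "finite D" using finY by (simp add: D_def)
    moreover have "bounded U \<and> diameter U \<le> \<delta>" if U: "U \<in> D" for U
    proof (cases "len [] \<le> \<delta>")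
      case True
      then have "U = cylinder F []" using U by (simp add: D_def)
      then show ?thesis using diameter_cylinder_le[of "[]"] compact_cylinder[of "[]"] True by (auto intro: compact_imp_bounded)
    next
      case False
      then obtain w i where wi: "(w, i) \<in> Y" "U = cylinder F (w @ [i])" using U by (auto simp: D_def c_def)
      then have v: "valid (w @ [i])" by (auto simp: Y_def X_def W_def words_def m_def)
      have "len (w @ [i]) \<le> \<delta>" using wi(1) by (simp add: Y_def)
      then show ?thesis
        using diameter_cylinder_le[OF v] compact_cylinder[OF v] wi(2) by (auto intro: compact_imp_bounded)
    qed
    ultimately have "covering_number \<delta> (attractor F) \<le> card D" by (intro covering_number_le)
    also have "card D \<le> 1 + card X * m"
    proof -
      have "card (c ` Y) \<le> card Y" using finY by (rule card_image_le)
      also have "\<dots> \<le> card (X \<times> {..<m})" using finX by (intro card_mono Y) simp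
      finally show ?thesis by (simp add: D_def card_cartesian_product)
    qed
    finally have "real (covering_number \<delta> (attractor F)) \<le> real (1 + card X * m)" by (simp only: of_nat_le_iff)
    also have "\<dots> \<le> \<delta> powr (-s) + (K * \<delta> powr (-s)) * m"
      using one cardX by (auto intro!: add_mono mult_right_mono)
    finally show ?thesis by (simp add: algebra_simps)
  qed
  moreover have "0 < 1 + real m * K" using K0 by (simp add: add_pos_nonneg)
  ultimately show ?thesis by blast
qed

lemma covering_number_lower:
  assumes "ennreal c \<le> hausdorff_premeasure s \<delta> (attractor F)" "0 < \<delta>" "0 < s"
  shows "c * \<delta> powr (-s) \<le> real (covering_number \<delta> (attractor F))"
proof -
  obtain D where D: "finite D" "card D = covering_number \<delta> (attractor F)" "attractor F \<subseteq> \<Union>D"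
      "\<And>U. U \<in> D \<Longrightarrow> bounded U \<and> diameter U \<le> \<delta>"
    using finite_cover_exists[OF assms(2)] by blast
  have "hausdorff_premeasure s \<delta> (attractor F) \<le> ennreal (\<Sum>U\<in>D. rpow (diameter U) s)"
    using D(1,3,4) less_imp_le[OF assms(2)] by (intro premeasure_le_finite_cover) simp_all
  with assms(1) have "ennreal c \<le> ennreal (\<Sum>U\<in>D. rpow (diameter U) s)" by (rule order_trans)
  then have "c \<le> (\<Sum>U\<in>D. rpow (diameter U) s)"
    by (subst (asm) ennreal_le_iff) (auto intro: sum_nonneg rpow_nonneg)
  also have "\<dots> \<le> (\<Sum>U\<in>D. \<delta> powr s)"
    unfolding rpow_eq_powr[OF assms(2), symmetric]
    using D(4) assms(3) by (intro sum_mono rpow_mono) (auto intro: diameter_ge_0)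
  also have "\<dots> = real (covering_number \<delta> (attractor F)) * \<delta> powr s" by (simp add: D(2))
  finally show ?thesis using assms(2) by (simp add: powr_minus field_simps)
qed

lemma len_Nil: "measure lborel I = hi - lo"
  using lo_le_hi by (simp add: I_eq)

text \<open>If the base interval were a single point, all maps would fix it, and the
  first cylinders would not be disjoint.\<close>

lemma len_pos:
  assumes "2 \<le> length F" "valid w"
  shows "0 < len w"
proof -
  have "lo \<noteq> hi"
  proof
    assume "lo = hi"
    then have I: "I = {lo}" using I_eq by simp
    have "F ! 0 \<in> set F" using assms(1) by (intro nth_mem) linarith
    moreover have "F ! 1 \<in> set F" using assms(1) by (intro nth_mem) linarith
    ultimately have "(F ! 0) lo = lo" "(F ! 1) lo = lo" using base_interval_properties(4) I by auto
    then have "cylinder F [0] \<inter> cylinder F [1] \<noteq> {}" using I by (auto simp: cylinder_Cons)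
    then show False
      using separated[unfolded iosc_def, rule_format, of 0 1] assms(1) F_nonempty by simp
  qed
  then have "0 < len []" using lo_le_hi by (simp add: len_Nil)
  then have "0 < \<rho> ^ length w * len []" using \<rho>_pos by simp
  also have "\<dots> \<le> len w" using len_lower[OF assms(2)] .
  finally show ?thesis .
qed

lemma words_nonempty: "words F n \<noteq> {}"
proof -
  have "replicate n 0 \<in> words F n" using F_nonempty by (auto simp: words_def)
  then show ?thesis by blast
qed

lemma cylinder_sum_pos:
  assumes "2 \<le> length F"
  shows "0 < cylinder_sum s n"
proof -
  have "0 < rpow (len w) s" if "w \<in> words F n" for w
    using len_pos[OF assms, of w] that by (simp add: words_def rpow_eq_powr)
  then show ?thesis unfolding cylinder_sum_def using finite_words words_nonempty by (intro sum_pos) auto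
qed

lemma natural_pressure_eq_limsup_ln:
  assumes "2 \<le> length F"
  shows "natural_pressure F s = limsup (\<lambda>n. ereal (ln (cylinder_sum s n) / real n))"
proof -
  have "\<not> cylinder_sum s n \<le> 0" for n using cylinder_sum_pos[OF assms, of s n] by simp
  then show ?thesis by (simp add: natural_pressure_eq elog_def)
qed

lemma cylinder_sum_shift:
  assumes "2 \<le> length F" "0 \<le> t"
  shows "cylinder_sum (s + t) n \<le> (r ^ n * len []) powr t * cylinder_sum s n"
    and "(\<rho> ^ n * len []) powr t * cylinder_sum s n \<le> cylinder_sum (s + t) n"
proof -
  have w: "0 < len w" "\<rho> ^ n * len [] \<le> len w" "len w \<le> r ^ n * len []" if "w \<in> words F n" for w
    using that len_pos[OF assms(1), of w] len_lower[of w] len_upper[of w] by (auto simp: words_def)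
  have pos: "0 < \<rho> ^ n * len []" using \<rho>_pos len_pos[OF assms(1), of "[]"] by simp
  have split: "rpow (len w) (s + t) = len w powr t * rpow (len w) s" if "w \<in> words F n" for w
    using w(1)[OF that] by (simp add: rpow_eq_powr powr_add)
  show "cylinder_sum (s + t) n \<le> (r ^ n * len []) powr t * cylinder_sum s n"
    unfolding cylinder_sum_def sum_distrib_left
  proof (rule sum_mono)
    fix v assume v: "v \<in> words F n"
    have "len v powr t \<le> (r ^ n * len []) powr t" using w[OF v] assms(2) by (intro powr_mono2) auto
    then show "rpow (len v) (s + t) \<le> (r ^ n * len []) powr t * rpow (len v) s"
      unfolding split[OF v] by (rule mult_right_mono) (rule rpow_nonneg)
  qed
  show "(\<rho> ^ n * len []) powr t * cylinder_sum s n \<le> cylinder_sum (s + t) n"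
    unfolding cylinder_sum_def sum_distrib_left
  proof (rule sum_mono)
    fix v assume v: "v \<in> words F n"
    have "(\<rho> ^ n * len []) powr t \<le> len v powr t" using w[OF v] pos assms(2) by (intro powr_mono2) auto
    then show "(\<rho> ^ n * len []) powr t * rpow (len v) s \<le> rpow (len v) (s + t)"
      unfolding split[OF v] by (rule mult_right_mono) (rule rpow_nonneg)
  qed
qed

lemma tendsto_affine_over_n: "(\<lambda>n. ereal (t * (a / real n + b))) \<longlonglongrightarrow> ereal (t * b)"
proof -
  have "(\<lambda>n. t * (a / real n + b)) \<longlonglongrightarrow> t * (0 + b)"
    by (intro tendsto_mult tendsto_add tendsto_const lim_const_over_n)
  then show ?thesis by simp
qed

text \<open>All cylinders of level \<open>n\<close> have lengths between \<open>\<rho> ^ n\<close> and \<open>r ^ n\<close>, up to a constant factor; so raising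
  the exponent by \<open>t\<close> changes the pressure by an amount between \<open>t ln \<rho>\<close> and \<open>t ln r\<close>.\<close>

lemma natural_pressure_shift:
  assumes "2 \<le> length F" "0 \<le> t"
  shows "natural_pressure F (s + t) \<le> ereal (t * ln r) + natural_pressure F s"
    and "ereal (t * ln \<rho>) + natural_pressure F s \<le> natural_pressure F (s + t)"
proof -
  define L where "L = len []"
  have L: "0 < L" using len_pos[OF assms(1), of "[]"] by (simp add: L_def)
  have ln: "ln ((q ^ n * L) powr t * cylinder_sum s n) / real n = t * (ln L / real n + ln q) + ln (cylinder_sum s n) / real n"
    if "0 < n" "0 < q" for n q
    using that L cylinder_sum_pos[OF assms(1), of s n]
    by (simp add: ln_mult ln_powr ln_realpow field_simps)
  note E = natural_pressure_eq_limsup_ln[OF assms(1)]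
  have "eventually (\<lambda>n. ereal (ln (cylinder_sum (s + t) n) / real n)
      \<le> ereal (t * (ln L / real n + ln r)) + ereal (ln (cylinder_sum s n) / real n)) sequentially"
    using eventually_gt_at_top[of 0]
  proof eventually_elim
    case (elim n)
    have "ln (cylinder_sum (s + t) n) \<le> ln ((r ^ n * L) powr t * cylinder_sum s n)"
      using cylinder_sum_shift(1)[OF assms, of s n] cylinder_sum_pos[OF assms(1), of "s + t" n] by (intro ln_mono) (auto simp: L_def)
    then have "ln (cylinder_sum (s + t) n) / real n \<le> ln ((r ^ n * L) powr t * cylinder_sum s n) / real n"
      by (rule divide_right_mono) simp
    then show ?case using ln[OF elim r_pos] by simp
  qed
  then have "natural_pressure F (s + t)
      \<le> limsup (\<lambda>n. ereal (t * (ln L / real n + ln r)) + ereal (ln (cylinder_sum s n) / real n))"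
    unfolding E by (rule Limsup_mono)
  also have "\<dots> = ereal (t * ln r) + natural_pressure F s"
    unfolding E by (rule ereal_limsup_lim_add[OF tendsto_affine_over_n]) simp
  finally show "natural_pressure F (s + t) \<le> ereal (t * ln r) + natural_pressure F s" .
  have "eventually (\<lambda>n. ereal (t * (ln L / real n + ln \<rho>)) + ereal (ln (cylinder_sum s n) / real n)
      \<le> ereal (ln (cylinder_sum (s + t) n) / real n)) sequentially"
    using eventually_gt_at_top[of 0]
  proof eventually_elim
    case (elim n)
    have "0 < (\<rho> ^ n * L) powr t * cylinder_sum s n" using L \<rho>_pos cylinder_sum_pos[OF assms(1)] by simp
    then have "ln ((\<rho> ^ n * L) powr t * cylinder_sum s n) \<le> ln (cylinder_sum (s + t) n)"
      using cylinder_sum_shift(2)[OF assms, of n s] by (intro ln_mono) (auto simp: L_def)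
    then have "ln ((\<rho> ^ n * L) powr t * cylinder_sum s n) / real n \<le> ln (cylinder_sum (s + t) n) / real n"
      by (rule divide_right_mono) simp
    then show ?case using ln[OF elim \<rho>_pos] by simp
  qed
  then have "limsup (\<lambda>n. ereal (t * (ln L / real n + ln \<rho>)) + ereal (ln (cylinder_sum s n) / real n))
      \<le> natural_pressure F (s + t)"
    unfolding E by (rule Limsup_mono)
  moreover have "limsup (\<lambda>n. ereal (t * (ln L / real n + ln \<rho>)) + ereal (ln (cylinder_sum s n) / real n))
      = ereal (t * ln \<rho>) + natural_pressure F s"
    unfolding E by (rule ereal_limsup_lim_add[OF tendsto_affine_over_n]) simp
  ultimately show "ereal (t * ln \<rho>) + natural_pressure F s \<le> natural_pressure F (s + t)" by simp
qed

lemma cylinder_sum_0: "cylinder_sum 0 n = real (length F) ^ n"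
  by (simp add: cylinder_sum_def rpow_def card_words)

lemma natural_pressure_0: "natural_pressure F 0 = ereal (ln (real (length F)))"
proof -
  have "eventually (\<lambda>n. ereal (1 / real n) * elog (cylinder_sum 0 n) = ereal (ln (real (length F)))) sequentially"
    using eventually_gt_at_top[of 0]
  proof eventually_elim
    case (elim n)
    then show ?case using F_nonempty by (simp add: cylinder_sum_0 elog_def not_le ln_realpow)
  qed
  then show ?thesis unfolding natural_pressure_eq
    by (subst Limsup_eq) (auto simp: Limsup_const)
qed

lemma natural_pressure_zero_many:
  assumes "2 \<le> length F"
  shows "\<exists>d\<ge>0. natural_pressure F d = 0 \<and> (\<forall>s>d. natural_pressure F s < 0) \<and>
    (\<forall>s. 0 \<le> s \<longrightarrow> s < d \<longrightarrow> 0 < natural_pressure F s)"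
proof -
  define \<phi> where "\<phi> s = real_of_ereal (natural_pressure F s)" for s
  have fin: "\<bar>natural_pressure F s\<bar> \<noteq> \<infinity>" if "0 \<le> s" for s
    using natural_pressure_shift[OF assms that, of 0]
    by (cases "natural_pressure F s") (auto simp: natural_pressure_0)
  have \<phi>: "natural_pressure F s = ereal (\<phi> s)" if "0 \<le> s" for s
    using fin[OF that] by (simp add: \<phi>_def ereal_real)
  have upper: "\<phi> u \<le> \<phi> s + (u - s) * ln r" and lower: "\<phi> s + (u - s) * ln \<rho> \<le> \<phi> u"
    if "0 \<le> s" "s \<le> u" for s u
    using natural_pressure_shift[OF assms, of "u - s" s] that by (simp_all add: \<phi> add.commute)
  have lnr: "ln r < 0" using r_pos r_less_1 by simp
  have ln\<rho>: "ln \<rho> < 0" using \<rho>_pos \<rho>_le_r r_less_1 by simp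
  have strict: "\<phi> u < \<phi> s" if "0 \<le> s" "s < u" for s u
    using upper[of s u] that lnr mult_pos_neg[of "u - s" "ln r"] by simp
  have "(- ln \<rho>)-lipschitz_on {0..} \<phi>"
  proof (rule lipschitz_onI)
    have *: "\<bar>\<phi> u - \<phi> s\<bar> \<le> - ln \<rho> * (u - s)" if "0 \<le> s" "s \<le> u" for s u
    proof -
      have "(u - s) * ln r \<le> 0" using that lnr by (intro mult_nonneg_nonpos) auto
      then have "\<phi> u \<le> \<phi> s" using upper[OF that] by linarith
      then show ?thesis using lower[OF that] by (simp add: algebra_simps)
    qed
    show "dist (\<phi> x) (\<phi> y) \<le> - ln \<rho> * dist x y" if "x \<in> {0..}" "y \<in> {0..}" for x y
      using that *[of x y] *[of y x] by (cases "x \<le> y") (simp_all add: dist_real_def abs_minus_commute)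
    show "0 \<le> - ln \<rho>" using ln\<rho> by simp
  qed
  then have cont: "continuous_on {0..} \<phi>" by (rule lipschitz_on_continuous_on)
  have \<phi>0: "\<phi> 0 = ln (real (length F))" by (simp add: \<phi>_def natural_pressure_0)
  \<comment> \<open>The upper bound for \<open>\<phi>\<close> vanishes at \<open>T\<close>, so the zero lies in \<open>{0..T}\<close>.\<close>
  define T where "T = ln (real (length F)) / - ln r"
  have T: "0 \<le> T" unfolding T_def using assms lnr by (intro divide_nonneg_pos) simp_all
  have "\<phi> T \<le> \<phi> 0 + (T - 0) * ln r" by (rule upper) (use T in auto)
  also have "\<dots> = 0" using lnr by (simp add: \<phi>0 T_def)
  finally have "\<phi> T \<le> 0" .
  moreover have "0 \<le> \<phi> 0" using assms by (simp add: \<phi>0)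
  ultimately obtain d where d: "0 \<le> d" "d \<le> T" "\<phi> d = 0"
    using IVT2'[of \<phi> T 0 0] T continuous_on_subset[OF cont, of "{0..T}"] by auto
  show ?thesis
  proof (intro exI[of _ d] conjI allI impI d(1))
    show "natural_pressure F d = 0" using \<phi>[OF d(1)] d(3) by simp
    show "natural_pressure F s < 0" if "d < s" for s
      using strict[OF d(1) that] \<phi>[of s] d that by simp
    show "0 < natural_pressure F s" if "0 \<le> s" "s < d" for s
      using strict[OF that] \<phi>[OF that(1)] d by simp
  qed
qed

text \<open>A single map has its fixed point as base interval, so all cylinders have length \<open>0\<close>, and
  the pressure is \<open>-\<infinity>\<close> at all positive exponents.\<close>

lemma natural_pressure_single:
  assumes "length F = 1" "0 < s"
  shows "natural_pressure F s < 0"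
proof -
  obtain f where F: "F = [f]" using assms(1) by (cases F) auto
  have "\<exists>!p. f p = p"
    using upper_lipschitz[of f] r_pos r_less_1 F by (intro banach_fix_type[of r]) (auto simp: dist_real_def)
  then obtain p where p: "f p = p" by blast
  have "I \<subseteq> {p}" unfolding base_interval_def
    by (rule Inter_lower) (auto simp: F p is_interval_1)
  moreover have "lo \<in> I" "hi \<in> I" using I_eq lo_le_hi by auto
  ultimately have "lo = hi" by blast
  then have "len w = 0" if "w \<in> words F n" for w n
    using that by (simp add: len_eq words_def)
  then have S0: "cylinder_sum s n = 0" for n
    using assms(2) by (simp add: cylinder_sum_def rpow_def)
  have "eventually (\<lambda>n. ereal (1 / real n) * elog (cylinder_sum s n) = - \<infinity>) sequentially"
    using eventually_gt_at_top[of 0] by eventually_elim (simp add: elog_def S0)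
  then have "natural_pressure F s = limsup (\<lambda>n. - \<infinity>)" unfolding natural_pressure_eq by (rule Limsup_eq)
  then show ?thesis by (simp add: Limsup_const)
qed

lemma natural_pressure_zero:
  obtains d where "0 \<le> d" "natural_pressure F d = 0" "\<And>s. d < s \<Longrightarrow> natural_pressure F s < 0"
    "\<And>s. 0 \<le> s \<Longrightarrow> s < d \<Longrightarrow> 2 \<le> length F \<and> 0 < natural_pressure F s"
proof (cases "2 \<le> length F")
  case True
  then show thesis using natural_pressure_zero_many[OF True] that by metis
next
  case False
  moreover have "length F \<noteq> 0" using F_nonempty by simp
  ultimately have "length F = 1" by linarith
  then show thesis using natural_pressure_single natural_pressure_0 that[of 0] by simp
qed

lemma natural_pressure_neg_of_geometric_bound:
  assumes "2 \<le> length F" "\<And>n. cylinder_sum s n \<le> C * \<theta> ^ n" "0 < \<theta>" "\<theta> < 1"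
  shows "natural_pressure F s < 0"
proof -
  have C: "0 < C" using assms(2)[of 0] cylinder_sum_pos[OF assms(1), of s 0] by simp
  have "eventually (\<lambda>n. ereal (ln (cylinder_sum s n) / real n) \<le> ereal (1 * (ln C / real n + ln \<theta>))) sequentially"
    using eventually_gt_at_top[of 0]
  proof eventually_elim
    case (elim n)
    have "ln (cylinder_sum s n) \<le> ln (C * \<theta> ^ n)" using cylinder_sum_pos[OF assms(1)] assms(2) by (intro ln_mono) auto
    also have "\<dots> = ln C + real n * ln \<theta>" using C assms(3) by (simp add: ln_mult ln_realpow)
    finally show ?case using elim by (simp add: field_simps)
  qed
  then have "natural_pressure F s \<le> limsup (\<lambda>n. ereal (1 * (ln C / real n + ln \<theta>)))"
    unfolding natural_pressure_eq_limsup_ln[OF assms(1)] by (rule Limsup_mono)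
  also have "\<dots> = ereal (1 * ln \<theta>)"
    by (rule lim_imp_Limsup[OF _ tendsto_affine_over_n]) simp
  also have "\<dots> < 0" using assms(3,4) by simp
  finally show ?thesis .
qed

end

section \<open>Singular words and affine compositions\<close>

lemma finite_compact_separation:
  fixes C :: "'i \<Rightarrow> 'a::heine_borel set"
  assumes "finite G" "\<And>i. i \<in> G \<Longrightarrow> compact (C i)"
    and "\<And>i j. i \<in> G \<Longrightarrow> j \<in> G \<Longrightarrow> i \<noteq> j \<Longrightarrow> C i \<inter> C j = {}"
  shows "\<exists>d>0. \<forall>i\<in>G. \<forall>j\<in>G. i \<noteq> j \<longrightarrow> (\<forall>x\<in>C i. \<forall>y\<in>C j. d \<le> dist x y)"
proof -
  define P where "P = {(i, j). i \<in> G \<and> j \<in> G \<and> i \<noteq> j}"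
  have finP: "finite P" using assms(1) by (intro finite_subset[of P "G \<times> G"]) (auto simp: P_def)
  have "\<forall>p\<in>P. \<exists>d>0. \<forall>x\<in>C (fst p). \<forall>y\<in>C (snd p). d \<le> dist x y"
  proof
    fix p assume p: "p \<in> P"
    have "compact (C (fst p))" "closed (C (snd p))" "C (fst p) \<inter> C (snd p) = {}"
      using p assms(2) assms(3)[of "fst p" "snd p"]
      by (simp_all add: P_def case_prod_unfold compact_imp_closed)
    then show "\<exists>d>0. \<forall>x\<in>C (fst p). \<forall>y\<in>C (snd p). d \<le> dist x y"
      by (rule separate_compact_closed)
  qed
  then obtain d where d: "\<forall>p\<in>P. 0 < d p \<and> (\<forall>x\<in>C (fst p). \<forall>y\<in>C (snd p). d p \<le> dist x y)"
    using bchoice[of P "\<lambda>p d. 0 < d \<and> (\<forall>x\<in>C (fst p). \<forall>y\<in>C (snd p). d \<le> dist x y)"] by blast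
  define D where "D = Min (insert 1 (d ` P))"
  have "0 < D" using d finP by (auto simp: D_def)
  moreover have "D \<le> dist x y" if "i \<in> G" "j \<in> G" "i \<noteq> j" "x \<in> C i" "y \<in> C j" for i j x y
  proof -
    have p: "(i, j) \<in> P" using that by (simp add: P_def)
    then have "D \<le> d (i, j)" using finP by (simp add: D_def)
    also have "\<dots> \<le> dist x y" using bspec[OF d p] that(4,5) by simp
    finally show ?thesis .
  qed
  ultimately show ?thesis by blast
qed

text \<open>With at least two maps all cylinders have positive length, so that ratios of lengths make sense.\<close>

locale separated_ifs_many = separated_ifs +
  assumes many: "2 \<le> length F"
begin

text \<open>The images of the break points rather than the break points themselves: then \<open>i # w\<close> is singular as
  soon as \<open>F ! i\<close> may fail to be affine on the cylinder of \<open>w\<close>. The point \<open>lo\<close> is added to make the empty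
  word singular, so that every word has a singular suffix.\<close>

definition singular_points :: "real set" where
  "singular_points = insert lo (\<Union>f\<in>set F. f ` B)"

definition singular :: "nat list \<Rightarrow> bool" where
  "singular w \<longleftrightarrow> cylinder F w \<inter> singular_points \<noteq> {}"

text \<open>No nonempty suffix of \<open>u\<close>, followed by \<open>v\<close>, is singular; \<open>v\<close> itself may be.\<close>

primrec regular :: "nat list \<Rightarrow> nat list \<Rightarrow> bool" where
  "regular v [] \<longleftrightarrow> True"
| "regular v (i # u) \<longleftrightarrow> \<not> singular (i # u @ v) \<and> regular v u"

lemma finite_singular_points: "finite singular_points"
  using finite_B by (simp add: singular_points_def)

lemma singular_Nil: "singular []"
  using I_eq lo_le_hi by (auto simp: singular_def singular_points_def)

lemma singular_prefix: "singular (v @ z) \<Longrightarrow> valid z \<Longrightarrow> singular v"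
  using cylinder_append_subset[of z v] by (auto simp: singular_def)

lemma regular_append: "regular v (u1 @ u2) \<longleftrightarrow> regular (u2 @ v) u1 \<and> regular v u2"
  by (induction u1) auto

lemma regular_imp_not_singular: "regular v u \<Longrightarrow> u \<noteq> [] \<Longrightarrow> \<not> singular (u @ v)"
  by (cases u) auto

lemma not_regular_obtain: "\<not> regular w v \<Longrightarrow> \<exists>i<length v. singular (drop i v @ w)"
proof (induction v)
  case (Cons a v)
  show ?case
  proof (cases "singular (a # v @ w)")
    case True
    then show ?thesis by (intro exI[of _ 0]) simp
  next
    case False
    then obtain i where "i < length v" "singular (drop i v @ w)" using Cons by auto
    then show ?thesis by (intro exI[of _ "Suc i"]) simp
  qed
qed simp

text \<open>Take for \<open>u2\<close> the longest suffix of \<open>u\<close> that is singular when followed by \<open>v\<close>.\<close>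

lemma singular_decomposition:
  assumes "singular v"
  shows "\<exists>u1 u2. u = u1 @ u2 \<and> singular (u2 @ v) \<and> regular (u2 @ v) u1"
proof (induction u)
  case Nil
  show ?case using assms by (intro exI[of _ "[]"]) simp
next
  case (Cons i u)
  show ?case
  proof (cases "singular (i # u @ v)")
    case True
    then show ?thesis by (intro exI[of _ "[]"] exI[of _ "i # u"]) simp
  next
    case False
    obtain u1 u2 where u: "u = u1 @ u2" "singular (u2 @ v)" "regular (u2 @ v) u1" using Cons by blast
    then show ?thesis using False by (intro exI[of _ "i # u1"] exI[of _ u2]) simp
  qed
qed

lemma regular_affine:
  assumes "valid u" "valid v" "regular v u"
  shows "\<exists>a c. \<forall>x\<in>cylinder F v. word_map F u x = a * x + c"
  using assms(1,3)
proof (induction u)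
  case Nil
  show ?case by (intro exI[of _ 1] exI[of _ 0]) simp
next
  case (Cons i u)
  then obtain a c where ac: "\<forall>x\<in>cylinder F v. word_map F u x = a * x + c" by auto
  have i: "F ! i \<in> set F" using Cons.prems(1) by simp
  have "is_interval (cylinder F (u @ v))" using Cons.prems(1) assms(2) by (intro is_interval_cylinder) simp
  moreover have "cylinder F (u @ v) \<inter> B = {}"
  proof -
    have "(F ! i) b \<in> cylinder F (i # u @ v) \<inter> singular_points" if "b \<in> cylinder F (u @ v) \<inter> B" for b
      using that i by (auto simp: cylinder_Cons singular_points_def)
    then show ?thesis using Cons.prems(2) unfolding singular_def regular.simps by blast
  qed
  ultimately obtain a' c' where ac': "\<forall>y\<in>cylinder F (u @ v). (F ! i) y = a' * y + c'"
    using affine[OF i] by blast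
  have "word_map F (i # u) x = (a' * a) * x + (a' * c + c')" if x: "x \<in> cylinder F v" for x
  proof -
    have "word_map F u x \<in> cylinder F (u @ v)" using x by (simp add: cylinder_append)
    then have "(F ! i) (word_map F u x) = a' * word_map F u x + c'" using ac' by blast
    then show ?thesis using ac x by (simp add: algebra_simps)
  qed
  then show ?case by blast
qed

lemma len_positive: "valid w \<Longrightarrow> 0 < len w"
  using len_pos[OF many] .

lemma endpoints_in_cylinder:
  "valid w \<Longrightarrow> word_map F w lo \<in> cylinder F w \<and> word_map F w hi \<in> cylinder F w"
  by (simp add: cylinder_eq_segment)

lemma regular_similarity:
  assumes "valid u" "valid v" "regular v u" "x \<in> cylinder F v" "y \<in> cylinder F v"
  shows "\<bar>word_map F u x - word_map F u y\<bar> = len (u @ v) / len v * \<bar>x - y\<bar>"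
proof -
  obtain a c where ac: "\<forall>x\<in>cylinder F v. word_map F u x = a * x + c"
    using regular_affine[OF assms(1-3)] by blast
  have sim: "\<bar>word_map F u x - word_map F u y\<bar> = \<bar>a\<bar> * \<bar>x - y\<bar>"
    if "x \<in> cylinder F v" "y \<in> cylinder F v" for x y
    using ac that by (simp flip: abs_mult right_diff_distrib)
  have "len (u @ v) = \<bar>a\<bar> * len v"
    using sim[of "word_map F v hi" "word_map F v lo"] endpoints_in_cylinder[OF assms(2)] assms(1,2)
    by (simp add: len_eq word_map_append)
  then show ?thesis using sim[OF assms(4,5)] len_positive[OF assms(2)] by simp
qed

text \<open>The slope of \<open>f\<^sub>u\<close> is the same on \<open>I\<^sub>v\<close> and on its part \<open>I\<^sub>v\<^sub>z\<close>. This is what remains of the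
  multiplicativity of cylinder lengths for self-similar sets.\<close>

lemma regular_ratio:
  assumes "valid u" "valid v" "valid z" "regular v u"
  shows "len (u @ v @ z) / len (v @ z) = len (u @ v) / len v"
proof -
  have vz: "valid (v @ z)" using assms by simp
  have sub: "cylinder F (v @ z) \<subseteq> cylinder F v" using cylinder_append_subset[OF assms(3)] .
  have "len (u @ v @ z) = len (u @ v) / len v * len (v @ z)"
    using regular_similarity[OF assms(1,2,4), of "word_map F (v @ z) hi" "word_map F (v @ z) lo"]
      endpoints_in_cylinder[OF vz] sub assms
    by (simp add: len_eq word_map_append subset_iff)
  then show ?thesis using len_positive[OF vz] by simp
qed

lemma wordsD: "w \<in> words F n \<Longrightarrow> valid w \<and> length w = n"
  by (simp add: words_def)

lemma ratio_upper: "valid u \<Longrightarrow> valid v \<Longrightarrow> len (u @ v) / len v \<le> r ^ length u"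
  using len_append_upper[of u v] len_positive[of v] by (simp add: field_simps)

lemma ratio_pos: "valid u \<Longrightarrow> valid v \<Longrightarrow> 0 < len (u @ v) / len v"
  using len_positive[of "u @ v"] len_positive[of v] by simp

text \<open>Different words of the same length have disjoint cylinders, so that no singular point is shared.\<close>

lemma card_singular_words:
  assumes "\<And>u. u \<in> A \<Longrightarrow> x @ u @ y \<in> words F n \<and> singular (x @ u @ y)"
  shows "card A \<le> card singular_points"
proof -
  have "\<forall>u\<in>A. \<exists>p. p \<in> cylinder F (x @ u @ y) \<inter> singular_points"
    using assms by (auto simp: singular_def)
  then obtain p where p: "\<forall>u\<in>A. p u \<in> cylinder F (x @ u @ y) \<inter> singular_points"
    using bchoice[of A "\<lambda>u p. p \<in> cylinder F (x @ u @ y) \<inter> singular_points"] by blast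
  have "inj_on p A"
  proof (rule inj_onI)
    fix u v assume uv: "u \<in> A" "v \<in> A" "p u = p v"
    have "p u \<in> cylinder F (x @ u @ y)" "p u \<in> cylinder F (x @ v @ y)"
      using bspec[OF p uv(1)] bspec[OF p uv(2)] uv(3) by simp_all
    then have "x @ u @ y = x @ v @ y" using assms uv(1,2) by (intro unique_word[where n = n]) blast+
    then show "u = v" by simp
  qed
  moreover have "p ` A \<subseteq> singular_points" using p by blast
  ultimately show ?thesis using finite_singular_points by (rule card_inj_on_le)
qed

section \<open>Renewal inequalities\<close>

definition regular_words :: "nat \<Rightarrow> nat list \<Rightarrow> nat list set" where
  "regular_words k v = {u \<in> words F k. regular v u}"

definition singular_words :: "nat \<Rightarrow> nat list \<Rightarrow> nat list set" where
  "singular_words j v = {u \<in> words F j. singular (u @ v)}"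

definition partition_sum :: "real \<Rightarrow> nat \<Rightarrow> nat list \<Rightarrow> real" where
  "partition_sum s k v = (\<Sum>u\<in>regular_words k v. (len (u @ v) / len v) powr s)"

lemma finite_regular_words: "finite (regular_words k v)"
  using finite_words by (simp add: regular_words_def)

lemma finite_singular_words: "finite (singular_words k v)"
  using finite_words by (simp add: singular_words_def)

lemma card_singular_words_le:
  assumes "valid v" "A \<subseteq> singular_words j v"
  shows "card A \<le> card singular_points"
proof (rule card_singular_words[of A "[]" v "j + length v"])
  fix u assume "u \<in> A"
  then show "[] @ u @ v \<in> words F (j + length v) \<and> singular ([] @ u @ v)"
    using assms by (auto simp: singular_words_def words_def)
qed

lemma sum_words_le:
  fixes g :: "nat list \<Rightarrow> real"
  assumes "singular v" "\<And>u. 0 \<le> g u"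
  shows "(\<Sum>u\<in>words F k. g u) \<le>
    (\<Sum>j\<le>k. \<Sum>u2\<in>singular_words j v. \<Sum>u1\<in>regular_words (k - j) (u2 @ v). g (u1 @ u2))"
proof -
  define X where "X = Sigma {..k} (\<lambda>j. Sigma (singular_words j v) (\<lambda>u2. regular_words (k - j) (u2 @ v)))"
  have "(\<Sum>j\<le>k. \<Sum>u2\<in>singular_words j v. \<Sum>u1\<in>regular_words (k - j) (u2 @ v). g (u1 @ u2)) =
      (\<Sum>(j, u2, u1)\<in>X. g (u1 @ u2))"
    unfolding X_def by (simp add: sum.Sigma finite_singular_words finite_regular_words)
  moreover have "(\<Sum>u\<in>words F k. g u) \<le> (\<Sum>(j, u2, u1)\<in>X. g (u1 @ u2))"
  proof (rule sum_le_included[where i = "\<lambda>(j, u2, u1). u1 @ u2"])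
    show "finite X" unfolding X_def
      by (intro finite_SigmaI finite_singular_words finite_regular_words) simp
    show "\<forall>u\<in>words F k. \<exists>y\<in>X. (case y of (j, u2, u1) \<Rightarrow> u1 @ u2) = u \<and> g u \<le> (case y of (j, u2, u1) \<Rightarrow> g (u1 @ u2))"
    proof
      fix u assume u: "u \<in> words F k"
      obtain u1 u2 where d: "u = u1 @ u2" "singular (u2 @ v)" "regular (u2 @ v) u1"
        using singular_decomposition[OF assms(1)] by blast
      have "(length u2, u2, u1) \<in> X"
        using u d by (auto simp: X_def words_def singular_words_def regular_words_def)
      then show "\<exists>y\<in>X. (case y of (j, u2, u1) \<Rightarrow> u1 @ u2) = u \<and> g u \<le> (case y of (j, u2, u1) \<Rightarrow> g (u1 @ u2))"
        using d(1) by (intro bexI[of _ "(length u2, u2, u1)"]) simp_all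
    qed
  qed (use assms(2) finite_words in auto)
  ultimately show ?thesis by simp
qed

text \<open>A word \<open>u\<close> that is regular over \<open>v z\<close> need not be regular over the shorter word \<open>v\<close>. Write \<open>u = u1 u2\<close>
  with \<open>u2\<close> the longest suffix for which \<open>u2 v\<close> is singular. Then \<open>u1\<close> is regular over \<open>u2 v\<close>, while
  \<open>u2\<close> contributes a factor of at most \<open>r\<close> per letter, and \<open>u2 v z\<close> is not singular
  unless \<open>u2\<close> is empty. The last condition is what makes the inequality useful: together with
  \<open>singular_rigidity\<close> it excludes all short nonempty \<open>u2\<close>.\<close>

lemma partition_sum_renewal:
  assumes v: "valid v" "valid z" "singular v" and s: "0 \<le> s"
  shows "partition_sum s k (v @ z) \<le> (\<Sum>j\<le>k. \<Sum>u2\<in>{u\<in>singular_words j v. u = [] \<or> \<not> singular (u @ v @ z)}.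
    (r powr s) ^ j * partition_sum s (k - j) (u2 @ v))"
proof -
  define g where "g u = (if regular (v @ z) u then (len (u @ v @ z) / len (v @ z)) powr s else 0)" for u
  have "partition_sum s k (v @ z) = (\<Sum>u\<in>words F k. g u)"
    unfolding partition_sum_def regular_words_def g_def
    using finite_words by (intro sum.mono_neutral_cong_left) auto
  also have "\<dots> \<le> (\<Sum>j\<le>k. \<Sum>u2\<in>singular_words j v. \<Sum>u1\<in>regular_words (k - j) (u2 @ v). g (u1 @ u2))"
    by (rule sum_words_le[OF v(3)]) (simp add: g_def)
  also have "\<dots> \<le> (\<Sum>j\<le>k. \<Sum>u2\<in>{u\<in>singular_words j v. u = [] \<or> \<not> singular (u @ v @ z)}.
      (r powr s) ^ j * partition_sum s (k - j) (u2 @ v))"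
  proof (rule sum_mono)
    fix j
    let ?E = "{u\<in>singular_words j v. u = [] \<or> \<not> singular (u @ v @ z)}"
    let ?h = "\<lambda>u2. \<Sum>u1\<in>regular_words (k - j) (u2 @ v). g (u1 @ u2)"
    have "(\<Sum>u2\<in>singular_words j v. ?h u2) = (\<Sum>u2\<in>?E. ?h u2)"
    proof (rule sum.mono_neutral_right[OF finite_singular_words])
      show "\<forall>u2\<in>singular_words j v - ?E. ?h u2 = 0"
      proof
        fix u2 assume "u2 \<in> singular_words j v - ?E"
        then have "u2 \<noteq> []" "singular (u2 @ v @ z)" by (auto simp: singular_words_def)
        then have "g (u1 @ u2) = 0" for u1
          using regular_imp_not_singular[of "v @ z" u2] by (auto simp: g_def regular_append)
        then show "?h u2 = 0" by simp
      qed
    qed auto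
    also have "\<dots> \<le> (\<Sum>u2\<in>?E. (r powr s) ^ j * partition_sum s (k - j) (u2 @ v))"
    proof (rule sum_mono)
      fix u2 assume "u2 \<in> ?E"
      then have u2: "valid u2" "length u2 = j" by (auto simp: singular_words_def words_def)
      show "?h u2 \<le> (r powr s) ^ j * partition_sum s (k - j) (u2 @ v)"
        unfolding partition_sum_def sum_distrib_left
      proof (rule sum_mono)
        fix u1 assume u1: "u1 \<in> regular_words (k - j) (u2 @ v)"
        then have u1': "valid u1" "regular (u2 @ v) u1" by (auto simp: regular_words_def words_def)
        let ?q = "len (u1 @ u2 @ v) / len (u2 @ v)"
        have q: "0 < ?q" using ratio_pos[of u1 "u2 @ v"] u1' u2 v by simp
        have "len ((u1 @ u2) @ v @ z) / len (v @ z) =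
            len (u1 @ (u2 @ v) @ z) / len ((u2 @ v) @ z) * (len (u2 @ (v @ z)) / len (v @ z))"
          using len_positive[of "u2 @ v @ z"] u2 v by simp
        also have "\<dots> \<le> ?q * r ^ j"
          using regular_ratio[of u1 "u2 @ v" z] u1' u2 v ratio_upper[of u2 "v @ z"] q
          by (intro mult_mono) auto
        finally have le: "len ((u1 @ u2) @ v @ z) / len (v @ z) \<le> ?q * r ^ j" .
        have "g (u1 @ u2) \<le> (?q * r ^ j) powr s"
        proof (cases "regular (v @ z) (u1 @ u2)")
          case True
          have "0 \<le> len ((u1 @ u2) @ v @ z) / len (v @ z)" by simp
          then show ?thesis using True powr_mono2[OF s _ le] by (simp add: g_def)
        qed (simp add: g_def)
        also have "\<dots> = (r powr s) ^ j * ?q powr s"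
        proof -
          have "(r ^ j) powr s = (r powr s) ^ j"
            using r_pos by (simp add: powr_powr mult.commute flip: powr_realpow)
          then show ?thesis using q r_pos by (simp only: powr_mult mult_ac)
        qed
        finally show "g (u1 @ u2) \<le> (r powr s) ^ j * ?q powr s" .
      qed
    qed
    finally show "(\<Sum>u2\<in>singular_words j v. ?h u2) \<le>
      (\<Sum>u2\<in>?E. (r powr s) ^ j * partition_sum s (k - j) (u2 @ v))" .
  qed
  finally show ?thesis .
qed

text \<open>The same decomposition, by the longest singular suffix, for all words.\<close>

lemma cylinder_sum_renewal:
  assumes s: "0 \<le> s"
  shows "cylinder_sum s n \<le> (\<Sum>j\<le>n. \<Sum>u2\<in>singular_words j []. len [] powr s * (r powr s) ^ j * partition_sum s (n - j) u2)"
proof -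
  have "cylinder_sum s n = (\<Sum>u\<in>words F n. len u powr s)"
    unfolding cylinder_sum_def using len_positive wordsD by (intro sum.cong rpow_eq_powr) auto
  also have "\<dots> \<le> (\<Sum>j\<le>n. \<Sum>u2\<in>singular_words j []. \<Sum>u1\<in>regular_words (n - j) (u2 @ []). len (u1 @ u2) powr s)"
    by (rule sum_words_le[OF singular_Nil]) simp
  also have "\<dots> \<le> (\<Sum>j\<le>n. \<Sum>u2\<in>singular_words j []. len [] powr s * (r powr s) ^ j * partition_sum s (n - j) u2)"
    unfolding partition_sum_def sum_distrib_left append_Nil2
  proof (intro sum_mono)
    fix j u1 u2
    assume "u2 \<in> singular_words j []" "u1 \<in> regular_words (n - j) u2"
    then have u: "valid u1" "valid u2" "length u2 = j"
      by (auto simp: singular_words_def regular_words_def words_def)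
    let ?q = "len (u1 @ u2) / len u2"
    have q: "0 < ?q" using ratio_pos u by simp
    have "len (u1 @ u2) = ?q * len u2" using len_positive[OF u(2)] by simp
    also have "\<dots> \<le> ?q * (r ^ j * len [])" using len_upper[OF u(2)] u(3) q by (intro mult_left_mono) auto
    finally have "len (u1 @ u2) powr s \<le> (?q * (r ^ j * len [])) powr s"
      using s by (intro powr_mono2) auto
    also have "\<dots> = len [] powr s * (r powr s) ^ j * ?q powr s"
    proof -
      have "(r ^ j) powr s = (r powr s) ^ j"
        using r_pos by (simp add: powr_powr mult.commute flip: powr_realpow)
      then show ?thesis using q r_pos by (simp only: powr_mult mult_ac)
    qed
    finally show "len (u1 @ u2) powr s \<le> len [] powr s * (r powr s) ^ j * ?q powr s" .
  qed
  finally show ?thesis .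
qed

text \<open>If the cylinders of \<open>v z\<close> and of \<open>u v\<close> contain singular points \<open>b\<close> and \<open>b'\<close>, then \<open>f\<^sub>u b\<close> and \<open>b'\<close> both
  lie in the cylinder of \<open>u v\<close>. As there are finitely many \<open>u\<close> of length at most \<open>j\<close> and finitely many
  singular points, these two points coincide as soon as \<open>v\<close> is long enough for this cylinder to be shorter
  than all their positive distances. So \<open>b'\<close> lies in the cylinder of \<open>u v z\<close>.\<close>

lemma singular_rigidity:
  obtains l where "\<And>u v z. \<lbrakk>valid u; valid v; valid z; length u \<le> j; length v = l;
    singular (u @ v); singular (v @ z)\<rbrakk> \<Longrightarrow> singular (u @ v @ z)"
proof -
  define W where "W = (\<Union>i\<le>j. words F i)"
  define D where "D = (\<lambda>(u, b, b'). \<bar>word_map F u b - b'\<bar>) ` (W \<times> singular_points \<times> singular_points) - {0}"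
  have "finite W" unfolding W_def using finite_words by blast
  then have finD: "finite D" unfolding D_def using finite_singular_points by blast
  define \<epsilon> where "\<epsilon> = Min (insert 1 D)"
  have "\<forall>d\<in>D. 0 < d" by (auto simp: D_def)
  then have "0 < \<epsilon>" using finD by (simp add: \<epsilon>_def)
  then obtain l where l: "r ^ l * len [] < \<epsilon>"
    using eventually_happens'[OF sequentially_bot len_tendsto_0] by blast
  have "singular (u @ v @ z)"
    if u: "valid u" "valid v" "valid z" "length u \<le> j" "length v = l"
      and sing: "singular (u @ v)" "singular (v @ z)" for u v z
  proof -
    obtain b where b: "b \<in> cylinder F (v @ z)" "b \<in> singular_points" using sing(2) by (auto simp: singular_def)
    obtain b' where b': "b' \<in> cylinder F (u @ v)" "b' \<in> singular_points" using sing(1) by (auto simp: singular_def)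
    have "b \<in> cylinder F v" using b(1) cylinder_append_subset[OF u(3)] by blast
    then have "word_map F u b \<in> cylinder F (u @ v)" by (simp add: cylinder_append)
    then have "\<bar>word_map F u b - b'\<bar> \<le> len (u @ v)" using b'(1) u by (intro dist_le_len) auto
    also have "\<dots> \<le> r ^ length u * len v" using u by (intro len_append_upper)
    also have "\<dots> \<le> 1 * len v" using r_pos r_less_1 by (intro mult_right_mono power_le_one) auto
    also have "\<dots> \<le> r ^ l * len []" using len_upper[OF u(2)] u(5) by simp
    finally have small: "\<bar>word_map F u b - b'\<bar> < \<epsilon>" using l by simp
    have "word_map F u b = b'"
    proof (rule ccontr)
      assume "word_map F u b \<noteq> b'"
      moreover have "u \<in> W" using u by (auto simp: W_def words_def)
      ultimately have "\<bar>word_map F u b - b'\<bar> \<in> D"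
        unfolding D_def using b(2) b'(2) by (intro DiffI image_eqI[of _ _ "(u, b, b')"]) auto
      then have "\<epsilon> \<le> \<bar>word_map F u b - b'\<bar>" using finD by (simp add: \<epsilon>_def)
      then show False using small by simp
    qed
    moreover have "word_map F u b \<in> cylinder F (u @ v @ z)" using b(1) by (simp add: cylinder_append[of F u])
    ultimately show ?thesis using b'(2) by (auto simp: singular_def)
  qed
  then show thesis using that by blast
qed

lemma geometric_tail:
  fixes p :: real
  assumes "0 < p" "p < 1"
  shows "(\<Sum>j\<in>{i..k}. p ^ j) \<le> p ^ i / (1 - p)"
proof -
  have "(\<Sum>j\<in>{i..k}. p ^ j) = (if k < i then 0 else (p ^ i - p ^ Suc k) / (1 - p))"
    using assms by (simp add: sum_gp)
  also have "\<dots> \<le> p ^ i / (1 - p)"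
    using assms by (auto intro!: divide_right_mono)
  finally show ?thesis .
qed

lemma sum_atMost_split_0:
  fixes f :: "nat \<Rightarrow> real"
  shows "(\<Sum>j\<le>k. f j) = f 0 + (\<Sum>j\<in>{1..k}. f j)"
  by (simp add: sum.atMost_shift sum.atLeast1_atMost_eq)

text \<open>Finitely many words are short, and a common constant for them exists. A long word is written as \<open>x z\<close>
  with \<open>x\<close> of a fixed length \<open>l\<close>. In the renewal inequality over \<open>x\<close> the term with \<open>u2\<close> empty
  is controlled by the constant of \<open>x\<close>; by rigidity, \<open>l\<close> can be chosen such that every nonempty
  \<open>u2\<close> has more than \<open>i\<close> letters, where \<open>i\<close> is so large that all these terms together are at most half of the
  bound to be proved. This closes an induction on \<open>k\<close>.\<close>

lemma partition_sum_uniform_decay: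
  assumes s: "0 < s" and \<theta>: "r powr s < \<theta>"
    and decay: "\<And>v. valid v \<Longrightarrow> singular v \<Longrightarrow> \<exists>C. \<forall>k. partition_sum s k v \<le> C * \<theta> ^ k"
  obtains C where "0 \<le> C" "\<And>v k. valid v \<Longrightarrow> singular v \<Longrightarrow> partition_sum s k v \<le> C * \<theta> ^ k"
proof -
  define N where "N = real (card singular_points)"
  define q where "q = r powr s"
  define p where "p = q / \<theta>"
  have q: "0 < q" using r_pos by (simp add: q_def)
  have \<theta>0: "0 < \<theta>" using q \<theta> unfolding q_def by linarith
  have p: "0 < p" "p < 1" using q \<theta> \<theta>0 by (simp_all add: p_def q_def)
  have "(\<lambda>i. N * (p ^ Suc i / (1 - p))) \<longlonglongrightarrow> N * (0 / (1 - p))"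
    using p by (intro tendsto_intros LIMSEQ_Suc LIMSEQ_realpow_zero) auto
  then have "eventually (\<lambda>i. N * (p ^ Suc i / (1 - p)) < 1 / 2) sequentially"
    by (intro order_tendstoD(2)) auto
  then obtain i where i: "N * (p ^ Suc i / (1 - p)) < 1 / 2"
    using eventually_happens'[OF sequentially_bot] by blast
  obtain l where l: "\<And>u v z. \<lbrakk>valid u; valid v; valid z; length u \<le> i; length v = l;
      singular (u @ v); singular (v @ z)\<rbrakk> \<Longrightarrow> singular (u @ v @ z)"
    using singular_rigidity[of i] by blast
  define W where "W = {v \<in> (\<Union>n\<le>l. words F n). singular v}"
  have finW: "finite W" unfolding W_def using finite_words by simp
  have "\<forall>v\<in>W. \<exists>C. \<forall>k. partition_sum s k v \<le> C * \<theta> ^ k"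
    using decay by (auto simp: W_def words_def)
  then obtain c where c: "\<forall>v\<in>W. \<forall>k. partition_sum s k v \<le> c v * \<theta> ^ k"
    using bchoice[of W "\<lambda>v C. \<forall>k. partition_sum s k v \<le> C * \<theta> ^ k"] by blast
  define C where "C = (\<Sum>v\<in>W. \<bar>c v\<bar>)"
  have C0: "0 \<le> C" by (simp add: C_def sum_nonneg)
  have short: "partition_sum s k v \<le> C * \<theta> ^ k" if "valid v" "singular v" "length v \<le> l" for v k
  proof -
    have v: "v \<in> W" using that by (auto simp: W_def words_def)
    have "\<bar>c v\<bar> \<le> C" unfolding C_def by (rule member_le_sum[OF v _ finW]) simp
    then have "c v * \<theta> ^ k \<le> C * \<theta> ^ k" using \<theta>0 by (intro mult_right_mono) auto
    then show ?thesis using c v by (meson order_trans)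
  qed
  have "partition_sum s k v \<le> 2 * C * \<theta> ^ k" if "valid v" "singular v" for v k
    using that
  proof (induction k arbitrary: v rule: less_induct)
    case (less k)
    show ?case
    proof (cases "length v \<le> l")
      case True
      then have "partition_sum s k v \<le> C * \<theta> ^ k" using short less.prems by blast
      also have "\<dots> \<le> 2 * C * \<theta> ^ k" using C0 \<theta>0 by simp
      finally show ?thesis .
    next
      case False
      define x z where "x = take l v" and "z = drop l v"
      have v: "v = x @ z" "length x = l" using False by (simp_all add: x_def z_def)
      have val: "valid x" "valid z" using less.prems(1) v(1) by auto
      have sx: "singular x" using less.prems(2) v(1) val(2) singular_prefix by blast
      let ?E = "\<lambda>j. {u\<in>singular_words j x. u = [] \<or> \<not> singular (u @ x @ z)}"
      let ?t = "\<lambda>j. \<Sum>u2\<in>?E j. q ^ j * partition_sum s (k - j) (u2 @ x)"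
      have first: "?t 0 \<le> C * \<theta> ^ k"
      proof -
        have "?E 0 = {[]}" using sx by (auto simp: singular_words_def words_def)
        then show ?thesis using short[OF val(1) sx, of k] v(2) by simp
      qed
      have late: "?t j \<le> (if i < j then 2 * C * \<theta> ^ k * (N * p ^ j) else 0)" if j: "j \<in> {1..k}" for j
      proof (cases "i < j")
        case False
        have "?E j = {}"
        proof (rule ccontr)
          assume "?E j \<noteq> {}"
          then obtain u where u: "u \<in> singular_words j x" "u = [] \<or> \<not> singular (u @ x @ z)" by blast
          then have "valid u" "length u = j" "singular (u @ x)" by (auto simp: singular_words_def words_def)
          moreover from this have "singular (u @ x @ z)"
            using l[OF _ val, of u] False v less.prems(2) by simp
          ultimately show False using u(2) j by auto
        qed
        then show ?thesis using False by (simp only: sum.empty if_False)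
      next
        case True
        have "?t j \<le> (\<Sum>u2\<in>?E j. q ^ j * (2 * C * \<theta> ^ (k - j)))"
        proof (rule sum_mono)
          fix u2 assume "u2 \<in> ?E j"
          then have "valid (u2 @ x)" "singular (u2 @ x)" using val by (auto simp: singular_words_def words_def)
          then show "q ^ j * partition_sum s (k - j) (u2 @ x) \<le> q ^ j * (2 * C * \<theta> ^ (k - j))"
            using j q by (intro mult_left_mono less.IH) auto
        qed
        also have "\<dots> = real (card (?E j)) * (q ^ j * (2 * C * \<theta> ^ (k - j)))" by simp
        also have "\<dots> \<le> N * (q ^ j * (2 * C * \<theta> ^ (k - j)))"
          unfolding N_def using card_singular_words_le[OF val(1), of "?E j" j] C0 q \<theta>0
          by (intro mult_right_mono) auto
        also have "\<dots> = 2 * C * \<theta> ^ k * (N * p ^ j)"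
          using j \<theta>0 by (simp add: p_def power_divide power_diff field_simps)
        finally show ?thesis using True by simp
      qed
      have "partition_sum s k v \<le> (\<Sum>j\<le>k. ?t j)"
        unfolding v(1) q_def using s by (intro partition_sum_renewal val sx) simp
      also have "\<dots> = ?t 0 + (\<Sum>j\<in>{1..k}. ?t j)"
        by (rule sum_atMost_split_0)
      also have "\<dots> \<le> C * \<theta> ^ k + (\<Sum>j\<in>{1..k}. if i < j then 2 * C * \<theta> ^ k * (N * p ^ j) else 0)"
        by (intro add_mono first sum_mono late)
      also have "(\<Sum>j\<in>{1..k}. if i < j then 2 * C * \<theta> ^ k * (N * p ^ j) else 0) =
          (\<Sum>j\<in>{Suc i..k}. 2 * C * \<theta> ^ k * (N * p ^ j))"
        by (rule sum.mono_neutral_cong_right) auto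
      also have "\<dots> = 2 * C * \<theta> ^ k * (N * (\<Sum>j\<in>{Suc i..k}. p ^ j))"
        by (simp add: sum_distrib_left)
      also have "\<dots> \<le> 2 * C * \<theta> ^ k * (N * (p ^ Suc i / (1 - p)))"
        using C0 \<theta>0 by (intro mult_left_mono geometric_tail p) (auto simp: N_def)
      also have "\<dots> \<le> 2 * C * \<theta> ^ k * (1 / 2)"
        using C0 \<theta>0 i by (intro mult_left_mono) auto
      finally show ?thesis by simp
    qed
  qed
  then show thesis using C0 that[of "2 * C"] by simp
qed

lemma cylinder_sum_geometric_bound:
  assumes s: "0 < s" and \<theta>: "r powr s < \<theta>"
    and decay: "\<And>v. valid v \<Longrightarrow> singular v \<Longrightarrow> \<exists>C. \<forall>k. partition_sum s k v \<le> C * \<theta> ^ k"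
  shows "\<exists>C. \<forall>n. cylinder_sum s n \<le> C * \<theta> ^ n"
proof -
  obtain C where C: "0 \<le> C" "\<And>v k. valid v \<Longrightarrow> singular v \<Longrightarrow> partition_sum s k v \<le> C * \<theta> ^ k"
    using partition_sum_uniform_decay[OF assms] by blast
  define N where "N = real (card singular_points)"
  define L where "L = len [] powr s"
  define q where "q = r powr s"
  define p where "p = q / \<theta>"
  have q: "0 < q" using r_pos by (simp add: q_def)
  have \<theta>0: "0 < \<theta>" using q \<theta> unfolding q_def by linarith
  have p: "0 < p" "p < 1" using q \<theta> \<theta>0 by (simp_all add: p_def q_def)
  have L: "0 \<le> L" by (simp add: L_def)
  have "cylinder_sum s n \<le> (L * N * C / (1 - p)) * \<theta> ^ n" for n
  proof -
    have "cylinder_sum s n \<le> (\<Sum>j\<le>n. \<Sum>u2\<in>singular_words j []. L * q ^ j * partition_sum s (n - j) u2)"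
      unfolding L_def q_def using s by (intro cylinder_sum_renewal) simp
    also have "\<dots> \<le> (\<Sum>j\<le>n. L * N * C * \<theta> ^ n * p ^ j)"
    proof (rule sum_mono)
      fix j assume j: "j \<in> {..n}"
      have "(\<Sum>u2\<in>singular_words j []. L * q ^ j * partition_sum s (n - j) u2)
          \<le> (\<Sum>u2\<in>singular_words j []. L * q ^ j * (C * \<theta> ^ (n - j)))"
        using L q by (intro sum_mono mult_left_mono C(2)) (auto simp: singular_words_def words_def)
      also have "\<dots> = real (card (singular_words j [])) * (L * q ^ j * (C * \<theta> ^ (n - j)))" by simp
      also have "\<dots> \<le> N * (L * q ^ j * (C * \<theta> ^ (n - j)))"
        unfolding N_def using card_singular_words_le[of "[]" "singular_words j []" j] C(1) q \<theta>0 L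
        by (intro mult_right_mono) auto
      also have "\<dots> = L * N * C * \<theta> ^ n * p ^ j"
        using j \<theta>0 by (simp add: p_def power_divide power_diff field_simps)
      finally show "(\<Sum>u2\<in>singular_words j []. L * q ^ j * partition_sum s (n - j) u2) \<le> L * N * C * \<theta> ^ n * p ^ j" .
    qed
    also have "\<dots> = L * N * C * \<theta> ^ n * (\<Sum>j\<in>{0..n}. p ^ j)"
      by (simp add: sum_distrib_left atLeast0AtMost)
    also have "\<dots> \<le> L * N * C * \<theta> ^ n * (p ^ 0 / (1 - p))"
      using L C(1) \<theta>0 by (intro mult_left_mono geometric_tail p) (auto simp: N_def)
    finally show ?thesis by simp
  qed
  then show ?thesis by blast
qed

section \<open>The lower bound\<close>

text \<open>All slopes of regular words of length \<open>k\<close> are at most \<open>r ^ k\<close>; so lowering the exponent gains an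
  exponential factor.\<close>

lemma partition_sum_exponent:
  assumes v: "valid v" and "t \<le> s"
  shows "(r powr (s - t)) ^ k * partition_sum t k v \<ge> partition_sum s k v"
  unfolding partition_sum_def sum_distrib_left
proof (rule sum_mono)
  fix u assume "u \<in> regular_words k v"
  then have u: "valid u" "length u = k" by (auto simp: regular_words_def words_def)
  let ?q = "len (u @ v) / len v"
  have q: "0 < ?q" "?q \<le> r ^ k" using ratio_pos[OF u(1) v] ratio_upper[OF u(1) v] u(2) by auto
  have "?q powr s = ?q powr (s - t) * ?q powr t" by (simp flip: powr_add)
  also have "\<dots> \<le> (r ^ k) powr (s - t) * ?q powr t"
    using q assms(2) by (intro mult_right_mono powr_mono2) auto
  also have "(r ^ k) powr (s - t) = (r powr (s - t)) ^ k"
    using r_pos by (simp add: powr_powr mult.commute flip: powr_realpow)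
  finally show "?q powr s \<le> (r powr (s - t)) ^ k * ?q powr t" .
qed

text \<open>The rate \<open>\<theta> = r\<^sup>s\<^sup>-\<^sup>t\<close> is the one that is gained by lowering the exponent from \<open>s\<close> to \<open>t\<close>, and it is admissible
  in \<open>cylinder_sum_geometric_bound\<close> since \<open>0 < t\<close>.\<close>

lemma partition_sum_unbounded:
  assumes "0 < t" "t < s" "0 \<le> natural_pressure F s"
  shows "\<exists>v. valid v \<and> (\<forall>C. \<exists>k. C < partition_sum t k v)"
proof -
  define \<theta> where "\<theta> = r powr (s - t)"
  have \<theta>: "0 < \<theta>" "\<theta> < 1" "r powr s < \<theta>"
    using assms(1,2) r_pos r_less_1 powr_less_mono'[of r "s - t" s] powr_less_mono'[of r 0 "s - t"]
    by (auto simp: \<theta>_def)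
  have "\<exists>v. valid v \<and> (\<forall>C. \<exists>k. C * \<theta> ^ k < partition_sum s k v)"
  proof (rule ccontr)
    assume "\<not> ?thesis"
    then have "\<forall>v. valid v \<longrightarrow> (\<exists>C. \<forall>k. partition_sum s k v \<le> C * \<theta> ^ k)" by (simp add: not_less)
    then have "\<exists>C. \<forall>n. cylinder_sum s n \<le> C * \<theta> ^ n"
      using cylinder_sum_geometric_bound[of s \<theta>] \<theta>(3) assms(1,2) by simp
    then obtain C where "\<And>n. cylinder_sum s n \<le> C * \<theta> ^ n" by blast
    then have "natural_pressure F s < 0"
      by (rule natural_pressure_neg_of_geometric_bound[OF many _ \<theta>(1,2)])
    then show False using assms(3) by simp
  qed
  then obtain v where v: "valid v" "\<And>C. \<exists>k. C * \<theta> ^ k < partition_sum s k v" by blast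
  have "\<exists>k. C < partition_sum t k v" for C
  proof -
    obtain k where "C * \<theta> ^ k < partition_sum s k v" using v(2) by blast
    also have "\<dots> \<le> \<theta> ^ k * partition_sum t k v"
      unfolding \<theta>_def using partition_sum_exponent[OF v(1)] assms(2) by simp
    finally have "\<theta> ^ k * C < \<theta> ^ k * partition_sum t k v" by (simp add: mult.commute)
    then have "C < partition_sum t k v" using \<theta>(1) by simp
    then show ?thesis by blast
  qed
  then show ?thesis using v(1) by blast
qed

text \<open>If \<open>f\<^sub>v\<close> is not known to be affine on \<open>I\<^sub>u\<^sub>v\<close>, then \<open>v' u v\<close> is singular for one of the nonempty
  suffixes \<open>v'\<close> of \<open>v\<close>, which leaves at most \<open>N\<close> words \<open>u\<close> for each suffix. They contribute at most \<open>1\<close> each.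
  This loss does not depend on \<open>k\<close>.\<close>

lemma partition_sum_return:
  assumes v: "valid v" and t: "0 \<le> t"
  shows "partition_sum t k v \<le> (\<Sum>u\<in>{u\<in>regular_words k v. regular (u @ v) v}. (len (u @ v) / len v) powr t)
    + real (length v * card singular_points)"
proof -
  let ?f = "\<lambda>u. (len (u @ v) / len v) powr t"
  define G where "G = {u\<in>regular_words k v. regular (u @ v) v}"
  define H where "H i = {u\<in>words F k. singular (drop i v @ u @ v)}" for i
  have finH: "finite (H i)" for i using finite_words by (simp add: H_def)
  have "regular_words k v - G \<subseteq> (\<Union>i<length v. H i)"
    using not_regular_obtain[of _ v] by (fastforce simp: G_def H_def regular_words_def)
  then have "card (regular_words k v - G) \<le> card (\<Union>i<length v. H i)"
    using finH by (intro card_mono) auto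
  also have "\<dots> \<le> (\<Sum>i<length v. card (H i))" by (rule card_UN_le) simp
  also have "\<dots> \<le> (\<Sum>i<length v. card singular_points)"
  proof (rule sum_mono)
    fix i
    have "valid (drop i v)" using v set_drop_subset[of i v] by blast
    then show "card (H i) \<le> card singular_points"
      using v by (intro card_singular_words[of _ "drop i v" v "length (drop i v) + (k + length v)"])
        (auto simp: H_def words_def)
  qed
  finally have card: "card (regular_words k v - G) \<le> length v * card singular_points" by simp
  have one: "?f u \<le> 1" if "u \<in> regular_words k v" for u
  proof -
    have u: "valid u" "length u = k" using that by (auto simp: regular_words_def words_def)
    have "len (u @ v) / len v \<le> 1"
      using ratio_upper[OF u(1) v, unfolded u(2)]
        power_le_one[OF less_imp_le[OF r_pos] less_imp_le[OF r_less_1], of k]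
      by linarith
    then show ?thesis using ratio_pos[OF u(1) v] t by (intro powr_le1) auto
  qed
  have "G \<subseteq> regular_words k v" by (auto simp: G_def)
  then have "partition_sum t k v = (\<Sum>u\<in>regular_words k v - G. ?f u) + (\<Sum>u\<in>G. ?f u)"
    unfolding partition_sum_def by (rule sum.subset_diff[OF _ finite_regular_words])
  also have "(\<Sum>u\<in>regular_words k v - G. ?f u) \<le> (\<Sum>u\<in>regular_words k v - G. 1)"
    using one by (intro sum_mono) auto
  also have "\<dots> \<le> real (length v * card singular_points)" using card by (simp only: sum_constant of_nat_le_iff mult_1_right)
  finally show ?thesis unfolding G_def by simp
qed

text \<open>The word \<open>v\<close> is fixed before \<open>k\<close> is chosen. Therefore the loss of \<open>partition_sum_return\<close> and
  the factor \<open>\<rho>\<^sup>|\<^sup>v\<^sup>|\<close> for the application of \<open>f\<^sub>v\<close> are constants, which a large partition sum outweighs.\<close>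

lemma premeasure_attractor_pos:
  assumes "0 < t" "t < s" "0 \<le> natural_pressure F s"
  shows "\<exists>c>0. \<forall>\<delta>. ennreal c \<le> hausdorff_premeasure t \<delta> (attractor F)"
proof -
  obtain v where v: "valid v" "\<And>C. \<exists>k. C < partition_sum t k v"
    using partition_sum_unbounded[OF assms] by blast
  define l where "l = length v"
  define M where "M = real (l * card singular_points)"
  have \<rho>1: "\<rho> ^ l \<le> 1" using \<rho>_pos \<rho>_le_r r_less_1 by (intro power_le_one) auto
  define A where "A = (\<rho> ^ l) powr t"
  have A: "0 < A" "A \<le> 1" using \<rho>_pos \<rho>1 assms(1) by (auto simp: A_def intro!: powr_le1)
  obtain k where k: "M + 1 / A < partition_sum t k v" using v(2) by blast
  \<comment> \<open>For \<open>k = 0\<close> and empty \<open>v\<close> the identity would be among the similarities.\<close>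
  have k0: "k \<noteq> 0"
  proof
    assume "k = 0"
    then have "regular_words k v = {[]}" by (auto simp: regular_words_def words_def)
    then have "partition_sum t k v = 1" using len_positive[OF v(1)] by (simp add: partition_sum_def)
    moreover have "1 \<le> 1 / A" using A by simp
    moreover have "0 \<le> M" by (simp add: M_def)
    ultimately show False using k by linarith
  qed
  define G where "G = {u\<in>regular_words k v. regular (u @ v) v}"
  have G: "valid u" "length u = k" "regular v u" "regular (u @ v) v" "u \<in> words F k" if "u \<in> G" for u
    using that by (auto simp: G_def regular_words_def words_def)
  have finG: "finite G" using finite_regular_words by (simp add: G_def)
  define \<kappa> where "\<kappa> u = len (v @ u @ v) / len v" for u
  define g where "g u = word_map F (v @ u)" for u
  define K where "K = attractor F \<inter> cylinder F v"
  have vw: "v \<in> words F l" using v(1) by (simp add: words_def l_def)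
  have comp: "compact K" unfolding K_def
    by (intro compact_Int_closed compact_attractor compact_imp_closed compact_cylinder v(1))
  have ne: "K \<noteq> {}"
  proof -
    obtain x where x: "x \<in> attractor F" using attractor_nonempty by blast
    then have "word_map F v x \<in> K"
      using word_map_attractor[OF vw] attractor_subset_I by (auto simp: K_def cylinder_def)
    then show ?thesis by blast
  qed
  have gcyl: "g u x \<in> cylinder F (v @ u @ v)" if "x \<in> K" for u x
    using that by (simp add: K_def g_def cylinder_append[of F "v @ u" v, simplified])
  have inv: "g u ` K \<subseteq> K" if u: "u \<in> G" for u
  proof -
    have "v @ u \<in> words F (l + k)" using vw G(5)[OF u] by (rule append_in_words)
    then have "g u ` K \<subseteq> attractor F" using word_map_attractor unfolding g_def K_def by blast
    moreover have "cylinder F (v @ u @ v) \<subseteq> cylinder F v"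
      using G(1)[OF u] v(1) by (intro cylinder_append_subset) simp
    ultimately show ?thesis using gcyl unfolding K_def by blast
  qed
  have pos: "0 < \<kappa> u" if u: "u \<in> G" for u
    using ratio_pos[of "v @ u" v] G(1)[OF u] v(1) by (simp add: \<kappa>_def)
  have lt1: "\<kappa> u < 1" if u: "u \<in> G" for u
  proof -
    have "\<kappa> u \<le> r ^ (l + k)"
      using ratio_upper[of "v @ u" v] G(1,2)[OF u] v(1) by (simp add: \<kappa>_def l_def)
    also have "\<dots> < 1" using r_pos r_less_1 k0 by (intro power_less_one_iff[THEN iffD2]) auto
    finally show ?thesis .
  qed
  have exp: "\<kappa> u * dist x y \<le> dist (g u x) (g u y)" if u: "u \<in> G" and xy: "x \<in> K" "y \<in> K" for u x y
  proof -
    have uv: "valid (u @ v)" using G(1)[OF u] v(1) by simp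
    have "\<bar>word_map F u x - word_map F u y\<bar> = len (u @ v) / len v * \<bar>x - y\<bar>"
      using xy by (intro regular_similarity G(1,3)[OF u] v(1)) (auto simp: K_def)
    moreover have "\<bar>word_map F v (word_map F u x) - word_map F v (word_map F u y)\<bar> =
        len (v @ u @ v) / len (u @ v) * \<bar>word_map F u x - word_map F u y\<bar>"
      using xy by (intro regular_similarity G(4)[OF u] v(1) uv) (auto simp: K_def cylinder_append)
    ultimately show ?thesis using len_positive[OF uv] by (simp add: dist_real_def g_def \<kappa>_def word_map_append)
  qed
  have "\<exists>d>0. \<forall>u\<in>G. \<forall>u'\<in>G. u \<noteq> u' \<longrightarrow>
      (\<forall>x\<in>cylinder F (v @ u @ v). \<forall>y\<in>cylinder F (v @ u' @ v). d \<le> dist x y)"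
  proof (rule finite_compact_separation[OF finG])
    fix u assume u: "u \<in> G"
    show "compact (cylinder F (v @ u @ v))" using G(1)[OF u] v(1) by (intro compact_cylinder) simp
    fix u' assume u': "u' \<in> G" "u \<noteq> u'"
    show "cylinder F (v @ u @ v) \<inter> cylinder F (v @ u' @ v) = {}"
      using append_in_words[OF vw append_in_words[OF G(5)[OF u] vw]]
        append_in_words[OF vw append_in_words[OF G(5)[OF u'(1)] vw]] u'(2)
      by (intro cylinder_disjoint[where n = "l + (k + l)"]) simp_all
  qed
  then obtain d where d: "0 < d" "\<forall>u\<in>G. \<forall>u'\<in>G. u \<noteq> u' \<longrightarrow>
      (\<forall>x\<in>cylinder F (v @ u @ v). \<forall>y\<in>cylinder F (v @ u' @ v). d \<le> dist x y)"
    by blast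
  have sep: "d \<le> dist (g u x) (g u' y)" if "u \<in> G" "u' \<in> G" "u \<noteq> u'" "x \<in> K" "y \<in> K" for u u' x y
    using d(2) that(1-3) gcyl[OF that(4), of u] gcyl[OF that(5), of u'] by simp
  have total: "1 \<le> (\<Sum>u\<in>G. \<kappa> u powr t)"
  proof -
    have "1 / A \<le> (\<Sum>u\<in>G. (len (u @ v) / len v) powr t)"
      using partition_sum_return[OF v(1), of t k] assms(1) k by (simp add: G_def M_def l_def)
    then have "1 \<le> A * (\<Sum>u\<in>G. (len (u @ v) / len v) powr t)" using A(1) by (simp add: field_simps)
    also have "\<dots> \<le> (\<Sum>u\<in>G. \<kappa> u powr t)"
      unfolding sum_distrib_left
    proof (rule sum_mono)
      fix u assume u: "u \<in> G"
      have uv: "valid (u @ v)" using G(1)[OF u] v(1) by simp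
      have q: "0 < len (u @ v) / len v" using ratio_pos[OF G(1)[OF u] v(1)] .
      have "\<rho> ^ l * (len (u @ v) / len v) \<le> \<kappa> u"
        using len_append_lower[OF v(1) uv] len_positive[OF v(1)] by (simp add: \<kappa>_def l_def divide_right_mono)
      then have "(\<rho> ^ l * (len (u @ v) / len v)) powr t \<le> \<kappa> u powr t"
        using q \<rho>_pos assms(1) by (intro powr_mono2) auto
      moreover have "(\<rho> ^ l * (len (u @ v) / len v)) powr t = A * (len (u @ v) / len v) powr t"
        unfolding A_def by (rule powr_mult)
      ultimately show "A * (len (u @ v) / len v) powr t \<le> \<kappa> u powr t" by simp
    qed
    finally show ?thesis .
  qed
  obtain c where c: "0 < c" "\<forall>\<delta>. ennreal c \<le> hausdorff_premeasure t \<delta> K"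
    using premeasure_lower_bound[OF comp ne inv finG pos lt1 exp d(1) sep assms(1) total] by blast
  have "K \<subseteq> attractor F" by (simp add: K_def)
  then have "hausdorff_premeasure t \<delta> K \<le> hausdorff_premeasure t \<delta> (attractor F)" for \<delta>
    by (rule hausdorff_premeasure_mono)
  then have "\<forall>\<delta>. ennreal c \<le> hausdorff_premeasure t \<delta> (attractor F)" using c(2) order_trans by blast
  then show ?thesis using c(1) by blast
qed

end

section \<open>The dimension formula\<close>

theorem theorem4p6:
  fixes F :: "(real \<Rightarrow> real) list"
  assumes "cplifs F" and "injective_ifs F" and "iosc F"
  shows "(\<exists>!s. 0 \<le> s \<and> natural_pressure F s = 0) \<and>
         hausdorff_dim (attractor F) = ereal (natural_dim F) \<and>
         has_box_dim (attractor F) (natural_dim F)"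
proof -
  have "\<forall>f\<in>set F. pw_affine_contraction f \<and> inj f"
    using assms(1,2) by (auto simp: cplifs_def injective_ifs_def)
  then obtain \<rho> r B where *: "0 < \<rho>" "r < 1" "finite B" "\<forall>f\<in>set F.
      (\<forall>x y. \<rho> * \<bar>x - y\<bar> \<le> \<bar>f x - f y\<bar> \<and> \<bar>f x - f y\<bar> \<le> r * \<bar>x - y\<bar>) \<and>
      (\<forall>J. is_interval J \<longrightarrow> J \<inter> B = {} \<longrightarrow> (\<exists>a c. \<forall>x\<in>J. f x = a * x + c))"
    using uniform_bilipschitz[of F] by blast
  interpret separated_ifs F \<rho> r B
  proof
    show "F \<noteq> []" using assms(1) by (simp add: cplifs_def)
  qed (use * assms(3) in simp_all)
  obtain d where d: "0 \<le> d" "natural_pressure F d = 0" "\<And>s. d < s \<Longrightarrow> natural_pressure F s < 0"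
    "\<And>s. 0 \<le> s \<Longrightarrow> s < d \<Longrightarrow> 2 \<le> length F \<and> 0 < natural_pressure F s"
    using natural_pressure_zero by blast
  have unique: "s = d" if "0 \<le> s \<and> natural_pressure F s = 0" for s
    using d(3)[of s] d(4)[of s] that by (cases s d rule: linorder_cases) auto
  have ex1: "\<exists>!s. 0 \<le> s \<and> natural_pressure F s = 0"
  proof (rule ex1I[of _ d])
    show "0 \<le> d \<and> natural_pressure F d = 0" using d(1,2) by (rule conjI)
  qed (rule unique)
  have dim: "natural_dim F = d"
    unfolding natural_dim_def
  proof (rule the_equality)
    show "0 \<le> d \<and> natural_pressure F d = 0" using d(1,2) by (rule conjI)
  qed (rule unique)
  have lower: "\<exists>c>0. \<forall>\<delta>. ennreal c \<le> hausdorff_premeasure t \<delta> (attractor F)" if t: "0 < t" "t < d" for t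
  proof -
    obtain s where s: "t < s" "s < d" using dense[OF t(2)] by blast
    have ps: "2 \<le> length F" "0 < natural_pressure F s" using d(4)[of s] s t by auto
    interpret separated_ifs_many F \<rho> r B by unfold_locales (rule ps(1))
    show ?thesis using premeasure_attractor_pos[OF t(1) s(1)] ps(2) by simp
  qed
  have "hausdorff_dim (attractor F) = ereal d"
  proof (rule antisym)
    show "hausdorff_dim (attractor F) \<le> ereal d"
    proof (rule ereal_le_epsilon2)
      fix e :: real assume "0 < e"
      then have "hausdorff_measure (d + e) (attractor F) = 0"
        using d(1,3) by (intro hausdorff_measure_eq_0) auto
      then have "hausdorff_dim (attractor F) \<le> ereal (d + e)"
        unfolding hausdorff_dim_def using d(1) \<open>0 < e\<close> by (intro Inf_lower) force
      then show "hausdorff_dim (attractor F) \<le> ereal d + ereal e" by simp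
    qed
    show "ereal d \<le> hausdorff_dim (attractor F)"
      unfolding hausdorff_dim_def
    proof (rule Inf_greatest)
      fix z assume "z \<in> {ereal s |s. 0 \<le> s \<and> hausdorff_measure s (attractor F) = 0}"
      then obtain s where s: "z = ereal s" "0 \<le> s" "hausdorff_measure s (attractor F) = 0" by blast
      have "d \<le> s"
      proof (rule ccontr)
        assume "\<not> d \<le> s"
        then have sd: "s < d" by simp
        have "s \<noteq> 0" using s(3) hausdorff_measure_0_nonempty[OF attractor_nonempty] by auto
        then obtain c where c: "0 < c" "ennreal c \<le> hausdorff_premeasure s 1 (attractor F)"
          using lower[of s] s(2) sd by force
        note c(2)
        also have "hausdorff_premeasure s 1 (attractor F) \<le> hausdorff_measure s (attractor F)"
          unfolding hausdorff_measure_def by (rule SUP_upper) simp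
        finally show False using s(3) c(1) by simp
      qed
      then show "ereal d \<le> z" using s(1) by simp
    qed
  qed
  moreover have "has_box_dim (attractor F) d"
  proof (rule has_box_dimI)
    show "\<exists>C>0. \<forall>\<delta>\<in>{0<..<1}. real (covering_number \<delta> (attractor F)) \<le> C * \<delta> powr (-s)" if "d < s" for s
      using covering_number_upper[OF d(3)[OF that]] d(1) that by simp
    show "\<exists>c>0. \<forall>\<delta>\<in>{0<..<1}. c * \<delta> powr (-s) \<le> real (covering_number \<delta> (attractor F))" if sd: "s < d" for s
    proof (cases "0 < s")
      case True
      then obtain c where "0 < c" "\<forall>\<delta>. ennreal c \<le> hausdorff_premeasure s \<delta> (attractor F)"
        using lower[OF True sd] by blast
      then show ?thesis using True by (intro exI[of _ c]) (auto intro: covering_number_lower)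
    next
      case False
      have "1 * \<delta> powr (-s) \<le> real (covering_number \<delta> (attractor F))" if \<delta>: "\<delta> \<in> {0<..<1}" for \<delta>
      proof -
        have "\<delta> powr (-s) \<le> 1" using False \<delta> by (intro powr_le1) auto
        also have "1 \<le> real (covering_number \<delta> (attractor F))" using covering_number_pos[of \<delta>] \<delta> by simp
        finally show ?thesis by simp
      qed
      then show ?thesis by (intro exI[of _ 1]) simp
    qed
    show "0 < covering_number \<delta> (attractor F)" if "\<delta> \<in> {0<..<1}" for \<delta>
      using covering_number_pos that by simp
  qed
  ultimately show ?thesis using ex1 by (simp add: dim)
qed

end
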